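(* Let $\lambda\in\mathfrak h^*$, let $\mathbb V^\lambda$ be a highest weight $\mathfrak g$-module with highest weight $\lambda$, and fix $w\in W$ that preserves $\operatorname{wt}\mathbb V^\lambda$. Let $J\subset J(\mathbb V^\lambda)$ and let $S\subset\operatorname{wt}\mathbb V^\lambda$ be a finite subset. Then $S=w(\operatorname{wt}_J\mathbb V^\lambda)$ if and only if $$|S|=|w(\operatorname{wt}_J\mathbb V^\lambda)|\quad\text{and}\quad\sum_{\mu\in S}\mu=\sum_{\mu\in w(\operatorname{wt}_J\mathbb V^\lambda)}\mu.$$ Moreover, the following equality of maximizer subsets holds: $$\operatorname{wt}_J\mathbb V^\lambda=(\operatorname{wt}\mathbb V^\lambda)(\rho_{I\setminus J})=(\operatorname{wt}_{J(\mathbb V^\lambda)}\mathbb V^\lambda)\bigl(\pi_{J(\mathbb V^\lambda)}\,\rho_{\operatorname{wt}_J\mathbb V^\lambda}\bigr).$$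
   Context: $\mathfrak g$ is a complex finite-dimensional semisimple Lie algebra with fixed triangular decomposition $\mathfrak g=\mathfrak n^+\oplus\mathfrak h\oplus\mathfrak n^-$, simple roots $\Delta=\{\alpha_i:i\in I\}$, fundamental weights $\{\omega_i:i\in I\}$, Chevalley generators $x^\pm_{\alpha_i}$ with $[x^+_{\alpha_i},x^-_{\alpha_j}]=\delta_{ij}h_i$ ($h_i$ the simple coroots), and Weyl group $W$. $(\cdot,\cdot)$ is the form on $\mathfrak h^*$ induced by the Killing form. For $J\subset I$: $\Delta_J=\{\alpha_j:j\in J\}$; $\rho_{I\setminus J}=\sum_{i\notin J}\omega_i$; $\pi_J:\mathfrak h^*\to\mathfrak h^*$ is the linear projection $\pi_J(\nu)=\sum_{j\in J}\nu(h_j)\omega_j$. For a finite set $X\subset\mathfrak h^*$, $\rho_X:=\sum_{x\in X}x$. A highest weight module $\mathbb V^\lambda$ is a nonzero quotient of the Verma module $M(\lambda)$; $v_\lambda$ is a highest weight vector; $\operatorname{wt}M$ is the set of weights of $M$. $\operatorname{wt}_J\mathbb V^\lambda:=\operatorname{wt}\mathbb V^\lambda\cap(\lambda-\mathbb Z_+\Delta_J)$, $J_\lambda:=\{i\in I:\lambda(h_i)\in\mathbb Z_+\}$, $J(\mathbb V^\lambda):=\{i\in J_\lambda:(x^-_{\alpha_i})^{\lambda(h_i)+1}v_\lambda=0\}$. (For $J\subset J(\mathbb V^\lambda)$ the set $\operatorname{wt}_J\mathbb V^\lambda$ is finite.) For $X\subset\mathfrak h^*$ and $\nu\in\mathfrak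 h^*$, the maximizer subset is $X(\nu):=\{x\in X:(\nu,x)-(\nu,x')\in[0,\infty)\ \forall x'\in X\}$. *)

theory Defs
  imports
    Complex_Main
    "HOL-Library.Function_Algebras"
    "HOL-Library.Poly_Mapping"
    "HOL-Library.Nonpos_Ints"
begin

text \<open>
  The underlying space of a Lie algebra, and of a module, is a whole type. The additive structure
  is that of the type, and the complex scalar multiplication is a record field.

  Functionals on a Cartan subalgebra \<open>H\<close> are functions on the Lie algebra that are linear on \<open>H\<close> and
  vanish outside \<open>H\<close>. With this normalisation equality of functions is equality of functionals, and
  sums and differences are the pointwise ones of \<^theory>\<open>HOL-Library.Function_Algebras\<close>.
\<close>

record 'g lie_alg =
  lscale :: "complex \<Rightarrow> 'g \<Rightarrow> 'g"
  lbracket :: "'g \<Rightarrow> 'g \<Rightarrow> 'g"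

record ('g, 'i) chev_lie_alg = "'g lie_alg" +
  cartan :: "'g set"
  nodes :: "'i set"
  sroot :: "'i \<Rightarrow> 'g \<Rightarrow> complex"
  xplus :: "'i \<Rightarrow> 'g"
  xminus :: "'i \<Rightarrow> 'g"

record ('g, 'v) lie_rep =
  mscale :: "complex \<Rightarrow> 'v \<Rightarrow> 'v"
  act :: "'g \<Rightarrow> 'v \<Rightarrow> 'v"


section \<open>Lie algebras\<close>

definition lie_algebra :: "('g::ab_group_add, 'b) lie_alg_scheme \<Rightarrow> bool" where
  "lie_algebra L \<longleftrightarrow>
     vector_space (lscale L) \<and>
     (\<forall>x. Vector_Spaces.linear (lscale L) (lscale L) (lbracket L x)) \<and>
     (\<forall>y. Vector_Spaces.linear (lscale L) (lscale L) (\<lambda>x. lbracket L x y)) \<and>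
     (\<forall>x. lbracket L x x = 0) \<and>
     (\<forall>x y z. lbracket L x (lbracket L y z) + lbracket L y (lbracket L z x)
                + lbracket L z (lbracket L x y) = 0)"

definition fin_dim :: "('g::ab_group_add, 'b) lie_alg_scheme \<Rightarrow> bool" where
  "fin_dim L \<longleftrightarrow> (\<exists>B. finite_dimensional_vector_space (lscale L) B)"

definition lie_subalgebra :: "('g::ab_group_add, 'b) lie_alg_scheme \<Rightarrow> 'g set \<Rightarrow> bool" where
  "lie_subalgebra L A \<longleftrightarrow>
     module.subspace (lscale L) A \<and> (\<forall>x\<in>A. \<forall>y\<in>A. lbracket L x y \<in> A)"

definition lie_ideal :: "('g::ab_group_add, 'b) lie_alg_scheme \<Rightarrow> 'g set \<Rightarrow> bool" where
  "lie_ideal L A \<longleftrightarrow>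
     module.subspace (lscale L) A \<and> (\<forall>x. \<forall>y\<in>A. lbracket L x y \<in> A)"

primrec derived_series :: "('g::ab_group_add, 'b) lie_alg_scheme \<Rightarrow> 'g set \<Rightarrow> nat \<Rightarrow> 'g set" where
  "derived_series L A 0 = A"
| "derived_series L A (Suc n) =
     module.span (lscale L)
       {lbracket L x y |x y. x \<in> derived_series L A n \<and> y \<in> derived_series L A n}"

definition lie_solvable :: "('g::ab_group_add, 'b) lie_alg_scheme \<Rightarrow> 'g set \<Rightarrow> bool" where
  "lie_solvable L A \<longleftrightarrow> (\<exists>n. derived_series L A n = {0})"

definition lie_semisimple :: "('g::ab_group_add, 'b) lie_alg_scheme \<Rightarrow> bool" where
  "lie_semisimple L \<longleftrightarrow> (\<forall>A. lie_ideal L A \<and> lie_solvable L A \<longrightarrow> A = {0})"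

text \<open>The trace of an endomorphism of a finite-dimensional space, computed in an arbitrary basis.\<close>

definition lin_trace :: "(complex \<Rightarrow> 'a::ab_group_add \<Rightarrow> 'a) \<Rightarrow> ('a \<Rightarrow> 'a) \<Rightarrow> complex" where
  "lin_trace s f =
     (let B = (SOME B. finite_dimensional_vector_space s B)
      in \<Sum>b\<in>B. module.representation s B (f b) b)"

definition killing :: "('g::ab_group_add, 'b) lie_alg_scheme \<Rightarrow> 'g \<Rightarrow> 'g \<Rightarrow> complex" where
  "killing L x y = lin_trace (lscale L) (lbracket L x \<circ> lbracket L y)"


section \<open>Cartan subalgebras, roots and triangular decompositions\<close>

definition ad_diagonalizable :: "('g::ab_group_add, 'b) lie_alg_scheme \<Rightarrow> 'g \<Rightarrow> bool" where
  "ad_diagonalizable L h \<longleftrightarrow>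
     module.span (lscale L) {x. \<exists>c. lbracket L h x = lscale L c x} = UNIV"

definition toral :: "('g::ab_group_add, 'b) lie_alg_scheme \<Rightarrow> 'g set \<Rightarrow> bool" where
  "toral L A \<longleftrightarrow> lie_subalgebra L A \<and> (\<forall>x\<in>A. \<forall>y\<in>A. lbracket L x y = 0) \<and>
     (\<forall>h\<in>A. ad_diagonalizable L h)"

text \<open>For a complex semisimple Lie algebra, a Cartan subalgebra is a maximal toral subalgebra.\<close>

definition cartan_subalgebra :: "('g::ab_group_add, 'b) lie_alg_scheme \<Rightarrow> 'g set \<Rightarrow> bool" where
  "cartan_subalgebra L A \<longleftrightarrow> toral L A \<and> (\<forall>B. toral L B \<and> A \<subseteq> B \<longrightarrow> B = A)"

definition hdual :: "('g::ab_group_add, 'i, 'b) chev_lie_alg_scheme \<Rightarrow> ('g \<Rightarrow> complex) set" where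
  "hdual L = {\<nu>. (\<forall>x\<in>cartan L. \<forall>y\<in>cartan L. \<nu> (x + y) = \<nu> x + \<nu> y) \<and>
                 (\<forall>c. \<forall>x\<in>cartan L. \<nu> (lscale L c x) = c * \<nu> x) \<and>
                 (\<forall>x. x \<notin> cartan L \<longrightarrow> \<nu> x = 0)}"

definition fscale :: "complex \<Rightarrow> ('g \<Rightarrow> complex) \<Rightarrow> 'g \<Rightarrow> complex" where
  "fscale c \<nu> = (\<lambda>x. c * \<nu> x)"

lemma vector_space_fscale: "vector_space fscale"
  by unfold_locales (auto simp: fscale_def fun_eq_iff algebra_simps)

definition root_space ::
  "('g::ab_group_add, 'i, 'b) chev_lie_alg_scheme \<Rightarrow> ('g \<Rightarrow> complex) \<Rightarrow> 'g set" where
  "root_space L \<beta> = {x. \<forall>h\<in>cartan L. lbracket L h x = lscale L (\<beta> h) x}"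

definition roots :: "('g::ab_group_add, 'i, 'b) chev_lie_alg_scheme \<Rightarrow> ('g \<Rightarrow> complex) set" where
  "roots L = {\<beta> \<in> hdual L. \<beta> \<noteq> 0 \<and> root_space L \<beta> \<noteq> {0}}"

text \<open>\<open>zplus L J\<close> is the set of nonnegative integer combinations of the \<open>\<alpha>\<^sub>j\<close>, \<open>j \<in> J\<close>.\<close>

definition zplus :: "('g, 'i, 'b) chev_lie_alg_scheme \<Rightarrow> 'i set \<Rightarrow> ('g \<Rightarrow> complex) set" where
  "zplus L J = {(\<Sum>j\<in>J. fscale (of_nat (c j)) (sroot L j)) |c :: 'i \<Rightarrow> nat. True}"

definition pos_roots :: "('g::ab_group_add, 'i, 'b) chev_lie_alg_scheme \<Rightarrow> ('g \<Rightarrow> complex) set" where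
  "pos_roots L = roots L \<inter> zplus L (nodes L)"

definition nplus :: "('g::ab_group_add, 'i, 'b) chev_lie_alg_scheme \<Rightarrow> 'g set" where
  "nplus L = module.span (lscale L) (\<Union>\<beta>\<in>pos_roots L. root_space L \<beta>)"

definition nminus :: "('g::ab_group_add, 'i, 'b) chev_lie_alg_scheme \<Rightarrow> 'g set" where
  "nminus L = module.span (lscale L) (\<Union>\<beta>\<in>pos_roots L. root_space L (- \<beta>))"

definition root_base :: "('g::ab_group_add, 'i, 'b) chev_lie_alg_scheme \<Rightarrow> bool" where
  "root_base L \<longleftrightarrow>
     finite (nodes L) \<and> inj_on (sroot L) (nodes L) \<and> sroot L ` nodes L \<subseteq> roots L \<and>
     \<not> module.dependent fscale (sroot L ` nodes L) \<and>
     module.span fscale (sroot L ` nodes L) = hdual L \<and>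
     (\<forall>\<beta>\<in>roots L. \<beta> \<in> zplus L (nodes L) \<or> - \<beta> \<in> zplus L (nodes L))"

definition triangular_decomposition :: "('g::ab_group_add, 'i, 'b) chev_lie_alg_scheme \<Rightarrow> bool" where
  "triangular_decomposition L \<longleftrightarrow>
     (\<forall>x. \<exists>!(p, h, m). p \<in> nplus L \<and> h \<in> cartan L \<and> m \<in> nminus L \<and> x = p + h + m)"

definition coroot :: "('g, 'i, 'b) chev_lie_alg_scheme \<Rightarrow> 'i \<Rightarrow> 'g" where
  "coroot L i = lbracket L (xplus L i) (xminus L i)"

text \<open>
  The bracket of the \<open>i\<close>-th raising and lowering generators lies in the line spanned by the coroot of
  \<open>\<alpha>\<^sub>i\<close>; it is the coroot exactly when \<open>\<alpha>\<^sub>i\<close> takes the value 2 on it.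
\<close>

definition chevalley_generators :: "('g::ab_group_add, 'i, 'b) chev_lie_alg_scheme \<Rightarrow> bool" where
  "chevalley_generators L \<longleftrightarrow>
     (\<forall>i\<in>nodes L. xplus L i \<in> root_space L (sroot L i) \<and>
                  xminus L i \<in> root_space L (- sroot L i) \<and>
                  sroot L i (coroot L i) = 2) \<and>
     (\<forall>i\<in>nodes L. \<forall>j\<in>nodes L. i \<noteq> j \<longrightarrow> lbracket L (xplus L i) (xminus L j) = 0) \<and>
     (\<forall>A. lie_subalgebra L A \<and> xplus L ` nodes L \<subseteq> A \<and> xminus L ` nodes L \<subseteq> A \<longrightarrow> A = UNIV)"

locale semisimple_chevalley =
  fixes L :: "('g::ab_group_add, 'i, 'b) chev_lie_alg_scheme" (structure)
  assumes lie_algebra: "lie_algebra L"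
    and fin_dim: "fin_dim L"
    and semisimple: "lie_semisimple L"
    and cartan: "cartan_subalgebra L (cartan L)"
    and root_base: "root_base L"
    and triangular: "triangular_decomposition L"
    and chevalley: "chevalley_generators L"


section \<open>The form on the dual, the Weyl group, fundamental weights\<close>

definition dual_elem ::
  "('g::ab_group_add, 'i, 'b) chev_lie_alg_scheme \<Rightarrow> ('g \<Rightarrow> complex) \<Rightarrow> 'g" where
  "dual_elem L \<nu> = (THE t. t \<in> cartan L \<and> (\<forall>h\<in>cartan L. killing L t h = \<nu> h))"

definition hform ::
  "('g::ab_group_add, 'i, 'b) chev_lie_alg_scheme \<Rightarrow> ('g \<Rightarrow> complex) \<Rightarrow> ('g \<Rightarrow> complex) \<Rightarrow> complex" where
  "hform L \<mu> \<nu> = killing L (dual_elem L \<mu>) (dual_elem L \<nu>)"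

definition root_reflection ::
  "('g::ab_group_add, 'i, 'b) chev_lie_alg_scheme \<Rightarrow> ('g \<Rightarrow> complex) \<Rightarrow> ('g \<Rightarrow> complex) \<Rightarrow> 'g \<Rightarrow> complex" where
  "root_reflection L \<beta> \<nu> = \<nu> - fscale (2 * hform L \<nu> \<beta> / hform L \<beta> \<beta>) \<beta>"

text \<open>
  Reflections are involutions, so the group they generate consists of their finite compositions. The
  elements are only meaningful as maps on \<open>hdual L\<close>.
\<close>

inductive_set weyl_group ::
  "('g::ab_group_add, 'i, 'b) chev_lie_alg_scheme \<Rightarrow> (('g \<Rightarrow> complex) \<Rightarrow> 'g \<Rightarrow> complex) set"
  for L :: "('g, 'i, 'b) chev_lie_alg_scheme" where
  weyl_id: "id \<in> weyl_group L"
| weyl_reflection: "\<beta> \<in> roots L \<Longrightarrow> w \<in> weyl_group L \<Longrightarrow> root_reflection L \<beta> \<circ> w \<in> weyl_group L"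

definition fund_weight ::
  "('g::ab_group_add, 'i, 'b) chev_lie_alg_scheme \<Rightarrow> 'i \<Rightarrow> 'g \<Rightarrow> complex" where
  "fund_weight L i =
     (THE \<omega>. \<omega> \<in> hdual L \<and> (\<forall>j\<in>nodes L. \<omega> (coroot L j) = (if i = j then 1 else 0)))"

definition rho_nodes ::
  "('g::ab_group_add, 'i, 'b) chev_lie_alg_scheme \<Rightarrow> 'i set \<Rightarrow> 'g \<Rightarrow> complex" where
  "rho_nodes L K = (\<Sum>i\<in>K. fund_weight L i)"

definition proj ::
  "('g::ab_group_add, 'i, 'b) chev_lie_alg_scheme \<Rightarrow> 'i set \<Rightarrow> ('g \<Rightarrow> complex) \<Rightarrow> 'g \<Rightarrow> complex" where
  "proj L J \<nu> = (\<Sum>j\<in>J. fscale (\<nu> (coroot L j)) (fund_weight L j))"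

definition rho_set :: "('g \<Rightarrow> complex) set \<Rightarrow> 'g \<Rightarrow> complex" where
  "rho_set X = (\<Sum>x\<in>X. x)"

definition maximizer ::
  "('g::ab_group_add, 'i, 'b) chev_lie_alg_scheme \<Rightarrow> ('g \<Rightarrow> complex) set \<Rightarrow> ('g \<Rightarrow> complex)
     \<Rightarrow> ('g \<Rightarrow> complex) set" where
  "maximizer L X \<nu> = {x \<in> X. \<forall>x'\<in>X. hform L \<nu> x - hform L \<nu> x' \<in> \<real>\<^sub>\<ge>\<^sub>0}"


section \<open>Verma modules and highest weight modules\<close>

definition lie_module ::
  "('g::ab_group_add, 'b) lie_alg_scheme \<Rightarrow> ('g, 'v::ab_group_add, 'c) lie_rep_scheme \<Rightarrow> bool" where
  "lie_module L V \<longleftrightarrow>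
     vector_space (mscale V) \<and>
     (\<forall>x. Vector_Spaces.linear (mscale V) (mscale V) (act V x)) \<and>
     (\<forall>v. Vector_Spaces.linear (lscale L) (mscale V) (\<lambda>x. act V x v)) \<and>
     (\<forall>x y v. act V (lbracket L x y) v = act V x (act V y v) - act V y (act V x v))"

text \<open>
  The space of finitely supported functions \<open>'g list \<Rightarrow>\<^sub>0 complex\<close> is the free associative algebra on
  the set \<open>'g\<close>, with the words as basis and concatenation as product. The universal enveloping
  algebra is its quotient by the two-sided ideal spanned by \<open>env_rels\<close>: the first two families of
  relations make the generators depend linearly on \<open>'g\<close>, the third is \<open>x y - y x = [x, y]\<close>. The Verma
  module is the quotient of the enveloping algebra by the left ideal generated by \<open>n\<^sup>+\<close> and the
  elements \<open>h - \<lambda>(h) 1\<close> for \<open>h\<close> in the Cartan subalgebra; so it is the quotient of the free algebra by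
  the left ideal \<open>verma_kernel\<close>.
\<close>

definition tscale :: "complex \<Rightarrow> ('a \<Rightarrow>\<^sub>0 complex) \<Rightarrow> 'a \<Rightarrow>\<^sub>0 complex" where
  "tscale c p = Poly_Mapping.map (\<lambda>a. c * a) p"

lemma lookup_tscale: "poly_mapping.lookup (tscale c p) k = c * poly_mapping.lookup p k"
  unfolding tscale_def by (simp add: map.rep_eq when_def)

lemma vector_space_tscale: "vector_space tscale"
  by unfold_locales
    (rule poly_mapping_eqI, simp add: lookup_tscale lookup_add distrib_left distrib_right mult.assoc)+

definition word :: "'g list \<Rightarrow> 'g list \<Rightarrow>\<^sub>0 complex" where
  "word u = Poly_Mapping.single u 1"

definition env_rels ::
  "('g::ab_group_add, 'b) lie_alg_scheme \<Rightarrow> ('g list \<Rightarrow>\<^sub>0 complex) set" where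
  "env_rels L =
     {word (u @ [x + y] @ w) - word (u @ [x] @ w) - word (u @ [y] @ w) |u w x y. True} \<union>
     {word (u @ [lscale L c x] @ w) - tscale c (word (u @ [x] @ w)) |u w c x. True} \<union>
     {word (u @ [x, y] @ w) - word (u @ [y, x] @ w) - word (u @ [lbracket L x y] @ w)
        |u w x y. True}"

definition verma_kernel ::
  "('g::ab_group_add, 'i, 'b) chev_lie_alg_scheme \<Rightarrow> ('g \<Rightarrow> complex)
     \<Rightarrow> ('g list \<Rightarrow>\<^sub>0 complex) set" where
  "verma_kernel L lam =
     module.span tscale
       (env_rels L \<union>
        {word (u @ [x]) |u x. x \<in> nplus L} \<union>
        {word (u @ [h]) - tscale (lam h) (word u) |u h. h \<in> cartan L})"

text \<open>
  A module \<open>V\<close> is a quotient of the Verma module of highest weight \<open>lam\<close> if it is the image of the free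
  algebra under a linear map that commutes with the left action of \<open>'g\<close> (given on words by
  prepending a letter) and vanishes on \<open>verma_kernel\<close>. The vector \<open>v\<close> is the image of 1, the empty
  word, that is, of the canonical generator of the Verma module.
\<close>

definition verma_quotient ::
  "('g::ab_group_add, 'i, 'b) chev_lie_alg_scheme \<Rightarrow> ('g \<Rightarrow> complex)
     \<Rightarrow> ('g, 'v::ab_group_add, 'c) lie_rep_scheme \<Rightarrow> 'v \<Rightarrow> bool" where
  "verma_quotient L lam V v \<longleftrightarrow>
     (\<exists>\<phi>. Vector_Spaces.linear tscale (mscale V) \<phi> \<and> surj \<phi> \<and>
          (\<forall>x u. \<phi> (word (x # u)) = act V x (\<phi> (word u))) \<and>
          (\<forall>p\<in>verma_kernel L lam. \<phi> p = 0) \<and>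
          \<phi> (word []) = v)"

definition highest_weight_module ::
  "('g::ab_group_add, 'i, 'b) chev_lie_alg_scheme \<Rightarrow> ('g \<Rightarrow> complex)
     \<Rightarrow> ('g, 'v::ab_group_add, 'c) lie_rep_scheme \<Rightarrow> 'v \<Rightarrow> bool" where
  "highest_weight_module L lam V v \<longleftrightarrow>
     lie_module L V \<and> verma_quotient L lam V v \<and> (UNIV :: 'v set) \<noteq> {0}"

definition weight_space ::
  "('g::ab_group_add, 'i, 'b) chev_lie_alg_scheme \<Rightarrow> ('g, 'v::ab_group_add, 'c) lie_rep_scheme
     \<Rightarrow> ('g \<Rightarrow> complex) \<Rightarrow> 'v set" where
  "weight_space L V \<mu> = {v. \<forall>h\<in>cartan L. act V h v = mscale V (\<mu> h) v}"

definition wt ::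
  "('g::ab_group_add, 'i, 'b) chev_lie_alg_scheme \<Rightarrow> ('g, 'v::ab_group_add, 'c) lie_rep_scheme
     \<Rightarrow> ('g \<Rightarrow> complex) set" where
  "wt L V = {\<mu> \<in> hdual L. weight_space L V \<mu> \<noteq> {0}}"

definition wt_J ::
  "('g::ab_group_add, 'i, 'b) chev_lie_alg_scheme \<Rightarrow> ('g \<Rightarrow> complex)
     \<Rightarrow> ('g, 'v::ab_group_add, 'c) lie_rep_scheme \<Rightarrow> 'i set \<Rightarrow> ('g \<Rightarrow> complex) set" where
  "wt_J L lam V J = wt L V \<inter> {lam - \<beta> |\<beta>. \<beta> \<in> zplus L J}"

definition J_lam :: "('g, 'i, 'b) chev_lie_alg_scheme \<Rightarrow> ('g \<Rightarrow> complex) \<Rightarrow> 'i set" where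
  "J_lam L lam = {i \<in> nodes L. lam (coroot L i) \<in> \<nat>}"

definition J_mod ::
  "('g, 'i, 'b) chev_lie_alg_scheme \<Rightarrow> ('g \<Rightarrow> complex)
     \<Rightarrow> ('g, 'v::ab_group_add, 'c) lie_rep_scheme \<Rightarrow> 'v \<Rightarrow> 'i set" where
  "J_mod L lam V v =
     {i \<in> J_lam L lam. \<forall>n. lam (coroot L i) = of_nat n \<longrightarrow> (act V (xminus L i) ^^ (n + 1)) v = 0}"

end

theory Submission
  imports Defs "HOL-Library.FuncSet"
begin

text \<open>
  The Killing form on the Cartan subalgebra is the sum of \<open>\<beta> \<otimes> \<beta>\<close> over the weights \<open>\<beta>\<close> of the adjoint
  representation, so it is positive definite on the real span of the coroots. This gives
  \<open>(\<omega>\<^sub>i, \<alpha>\<^sub>j) = \<delta>\<^sub>i\<^sub>j d\<^sub>j\<close> with \<open>d\<^sub>j > 0\<close>, without Cartan's criterion. As all weights of \<open>V\<close> lie in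
  \<open>\<lambda> - \<int>\<^sub>+\<Delta>\<close>, pairing with \<open>\<rho>\<close> of the complement of \<open>J\<close> attains its maximum over \<open>wt V\<close> exactly on
  \<open>wt\<^sub>J V\<close>, and a set of weights with as many elements and the same sum must attain it everywhere.

  For the last equality let \<open>r\<close> be the sum of \<open>wt\<^sub>J V\<close>. If \<open>j \<in> J\<close>, integrability makes \<open>wt\<^sub>J V\<close> stable
  under \<open>s\<^sub>j\<close>, so \<open>r(h\<^sub>j) = 0\<close>. If \<open>j \<in> J(V) - J\<close>, every weight in \<open>wt\<^sub>J V\<close> is nonnegative at \<open>h\<^sub>j\<close>, so
  \<open>r(h\<^sub>j) \<ge> 0\<close>; and \<open>r(h\<^sub>j) = 0\<close> means that \<open>f\<^sub>j\<close> kills these weight spaces, so such \<open>j\<close> add no weights.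
\<close>

text \<open>The highest weight is an arbitrary complex functional, so neither its square length nor
  its pairing with \<open>\<rho>\<close> need be real. Every positivity statement is therefore about
  a difference \<open>\<gamma> = \<lambda> - \<mu>\<close>, whose coefficients along the simple
  roots are natural numbers.

  Comparing cardinalities and sums is meaningful only if \<open>wt_J\<close> is finite, since
  \<open>card\<close> and \<open>sum\<close> of an infinite set are 0. Finiteness comes from
  lengths: integrability under the \<open>J\<close>-reflections bounds
  \<open>(\<gamma>, \<gamma>)\<close> by twice the real part of
  \<open>(\<lambda>, \<gamma>)\<close>, and positive definiteness then confines
  \<open>\<gamma>\<close> to a ball, which holds only finitely many integral points.

  The weights of \<open>V\<close> are read off from the vectors obtained by applying simple lowering
  generators to \<open>v\<close>, in any order; these span \<open>V\<close>, and no basis has to be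
  chosen. One computation with sl2-strings serves for the adjoint representation and for
  \<open>V\<close>, with the raising and lowering operators exchanged where needed. The Weyl group
  element is removed at the end by pulling \<open>S\<close> back along it.\<close>

lemma sum_fun_apply: "(\<Sum>x\<in>A. f x) h = (\<Sum>x\<in>A. f x h)"
  by (induction A rule: infinite_finite_induct) auto

lemma fscale_apply [simp]: "fscale c f h = c * f h"
  by (simp add: fscale_def)

lemma Nats_sum: "(\<And>i. i \<in> T \<Longrightarrow> f i \<in> \<nat>) \<Longrightarrow> (\<Sum>i\<in>T. f i) \<in> (\<nat> :: complex set)"
  by (induction T rule: infinite_finite_induct) auto

lemma nonneg_Reals_sum: "(\<And>i. i \<in> T \<Longrightarrow> f i \<in> \<real>\<^sub>\<ge>\<^sub>0) \<Longrightarrow> (\<Sum>i\<in>T. f i) \<in> (\<real>\<^sub>\<ge>\<^sub>0 :: complex set)"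
  by (induction T rule: infinite_finite_induct) (auto intro: nonneg_Reals_add_I)

lemma nonneg_Reals_Re:
  assumes "z \<in> \<real>\<^sub>\<ge>\<^sub>0"
  shows "z = complex_of_real (Re z)" "0 \<le> Re z"
  using assms by (auto simp: complex_nonneg_Reals_iff complex_eq_iff)

section \<open>Strings of an sl2-triple\<close>

text \<open>Moving \<open>E\<close> past one more \<open>F\<close> adds the next eigenvalue of
  \<open>H\<close>, and m + (m - 2) + ... + (m - 2k) = (k + 1)(m - k). Only scalar action of
  \<open>H\<close> along the string is required, so the roles of \<open>E\<close> and
  \<open>F\<close> can be exchanged by taking the negative of the coroot as
  \<open>H\<close>.\<close>

lemma sl2_string:
  fixes s :: "complex \<Rightarrow> 'v::ab_group_add \<Rightarrow> 'v"
  assumes E: "Vector_Spaces.linear s s E" and F: "Vector_Spaces.linear s s F"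
    and comm: "\<And>w. E (F w) - F (E w) = H w"
    and H: "\<And>k. H ((F ^^ k) u) = s (m - 2 * of_nat k) ((F ^^ k) u)"
    and Eu: "E u = 0"
  shows "E ((F ^^ Suc k) u) = s (of_nat (Suc k) * (m - of_nat k)) ((F ^^ k) u)"
proof -
  interpret E: Vector_Spaces.linear s s E by (fact E)
  interpret F: Vector_Spaces.linear s s F by (fact F)
  show ?thesis
  proof (induction k)
    case 0
    show ?case using comm[of u] H[of 0] Eu by (simp add: F.zero)
  next
    case (Suc k)
    have "E ((F ^^ Suc (Suc k)) u) = H ((F ^^ Suc k) u) + F (E ((F ^^ Suc k) u))"
      using comm[of "(F ^^ Suc k) u"] by (simp add: algebra_simps)
    also have "\<dots> = s (m - 2 * of_nat (Suc k)) ((F ^^ Suc k) u)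
                  + s (of_nat (Suc k) * (m - of_nat k)) ((F ^^ Suc k) u)"
      unfolding H Suc by (simp add: F.scale)
    also have "\<dots> = s (of_nat (Suc (Suc k)) * (m - of_nat (Suc k))) ((F ^^ Suc k) u)"
      unfolding E.vs1.scale_left_distrib[symmetric]
      by (rule arg_cong2[where f = s]) (simp_all add: algebra_simps)
    finally show ?case .
  qed
qed

text \<open>At the first vanishing power, with exponent k + 1, applying \<open>E\<close> leaves (k +
  1)(m - k) times a nonzero vector, which forces m = k.\<close>

lemma sl2_highest_weight_nat:
  fixes s :: "complex \<Rightarrow> 'v::ab_group_add \<Rightarrow> 'v"
  assumes E: "Vector_Spaces.linear s s E" and F: "Vector_Spaces.linear s s F"
    and comm: "\<And>w. E (F w) - F (E w) = H w"
    and H: "\<And>k. H ((F ^^ k) u) = s (m - 2 * of_nat k) ((F ^^ k) u)"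
    and Eu: "E u = 0" and u: "u \<noteq> 0" and nil: "(F ^^ N) u = 0"
  shows "\<exists>n. m = of_nat n \<and> (\<forall>k\<le>n. (F ^^ k) u \<noteq> 0) \<and> (F ^^ Suc n) u = 0"
proof -
  interpret E: Vector_Spaces.linear s s E by (fact E)
  define n where "n = (LEAST n. (F ^^ n) u = 0)"
  have n0: "(F ^^ n) u = 0" unfolding n_def by (rule LeastI[of _ N]) (rule nil)
  then obtain k where k: "n = Suc k" using u by (cases n) auto
  have lt: "(F ^^ i) u \<noteq> 0" if "i \<le> k" for i
    using not_less_Least[of i "\<lambda>n. (F ^^ n) u = 0"] that k unfolding n_def by simp
  have "s (of_nat (Suc k) * (m - of_nat k)) ((F ^^ k) u) = 0"
    using sl2_string[OF E F comm H Eu, of k] n0 k by (simp add: E.zero)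
  then have "m = of_nat k" using lt[of k] by (simp del: of_nat_Suc)
  with lt n0 k show ?thesis by auto
qed

section \<open>Traces\<close>

text \<open>Both sides expand to the same double sum of products of matrix entries of
  \<open>f\<close> and \<open>g\<close>. Allowing two bases lets one identity yield two facts: with
  \<open>g\<close> the identity the trace is independent of the basis, and with \<open>B = C\<close>
  it is invariant under commuting factors.\<close>

lemma basis_trace_commute:
  assumes B: "finite_dimensional_vector_space s B" and C: "finite_dimensional_vector_space s C"
    and f: "Vector_Spaces.linear s s f" and g: "Vector_Spaces.linear s s g"
  shows "(\<Sum>b\<in>B. module.representation s B (g (f b)) b)
       = (\<Sum>c\<in>C. module.representation s C (f (g c)) c)"
proof -
  interpret B: finite_dimensional_vector_space s B by (fact B)
  interpret C: finite_dimensional_vector_space s C by (fact C)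
  interpret f: Vector_Spaces.linear s s f by (fact f)
  interpret g: Vector_Spaces.linear s s g by (fact g)
  have *: "(B.representation B' (g' (f' b)) b)
       = (\<Sum>c\<in>C'. B.representation C' (f' b) c * B.representation B' (g' c) b)"
    if B': "finite_dimensional_vector_space s B'" and C': "finite_dimensional_vector_space s C'"
      and f': "Vector_Spaces.linear s s f'" and g': "Vector_Spaces.linear s s g'"
    for B' C' f' g' b
  proof -
    interpret B': finite_dimensional_vector_space s B' by (fact B')
    interpret C': finite_dimensional_vector_space s C' by (fact C')
    interpret f': Vector_Spaces.linear s s f' by (fact f')
    interpret g': Vector_Spaces.linear s s g' by (fact g')
    have "f' b = (\<Sum>c\<in>C'. s (B.representation C' (f' b) c) c)"
      by (rule B.sum_representation_eq[symmetric])
        (auto simp: C'.span_Basis C'.independent_Basis C'.finite_Basis)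
    then have "g' (f' b) = (\<Sum>c\<in>C'. s (B.representation C' (f' b) c) (g' c))"
      by (metis (no_types, lifting) g'.sum g'.scale sum.cong)
    then show ?thesis
      by (simp add: B.representation_sum B.representation_scale B'.span_Basis B'.independent_Basis)
  qed
  show ?thesis
    unfolding *[OF B C f g] *[OF C B g f] by (subst sum.swap) (simp add: mult.commute)
qed

lemma lin_trace_basis:
  assumes B: "finite_dimensional_vector_space s B" and f: "Vector_Spaces.linear s s f"
  shows "lin_trace s f = (\<Sum>b\<in>B. module.representation s B (f b) b)"
proof -
  interpret B: finite_dimensional_vector_space s B by (fact B)
  define C where "C = (SOME B. finite_dimensional_vector_space s B)"
  have C: "finite_dimensional_vector_space s C" unfolding C_def using B by (rule someI)
  have "Vector_Spaces.linear s s (\<lambda>x. x)" by (rule B.linear_ident)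
  from basis_trace_commute[OF C B f this] show ?thesis
    by (simp add: lin_trace_def C_def Let_def)
qed

lemma lin_trace_commute:
  assumes B: "finite_dimensional_vector_space s B"
    and f: "Vector_Spaces.linear s s f" and g: "Vector_Spaces.linear s s g"
  shows "lin_trace s (f \<circ> g) = lin_trace s (g \<circ> f)"
  using basis_trace_commute[OF B B f g] f g
  by (simp add: lin_trace_basis[OF B] Vector_Spaces.linear_compose)

lemma lin_trace_diff:
  assumes B: "finite_dimensional_vector_space s B"
    and f: "Vector_Spaces.linear s s f" and g: "Vector_Spaces.linear s s g"
  shows "lin_trace s (\<lambda>x. f x - g x) = lin_trace s f - lin_trace s g"
proof -
  interpret B: finite_dimensional_vector_space s B by (fact B)
  interpret P: vector_space_pair s s by unfold_locales
  have "Vector_Spaces.linear s s (\<lambda>x. f x - g x)"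
    using f g by (rule P.linear_compose_sub)
  then show ?thesis using f g
    by (simp add: lin_trace_basis[OF B] B.representation_diff B.span_Basis B.independent_Basis
        sum_subtractf)
qed

section \<open>Weight spaces of a module\<close>

text \<open>Used twice: for \<open>V\<close>, and for the adjoint representation, whose weight
  spaces are the root spaces.\<close>

locale lie_rep_on =
  fixes L :: "('g::ab_group_add, 'i, 'b) chev_lie_alg_scheme"
    and V :: "('g, 'v::ab_group_add, 'c) lie_rep_scheme"
  assumes lie_algebra: "lie_algebra L" and lie_module: "lie_module L V"
begin

sublocale vector_space "mscale V"
  using lie_module by (simp add: lie_module_def)

lemma linear_act: "Vector_Spaces.linear (mscale V) (mscale V) (act V x)"
  using lie_module by (simp add: lie_module_def)

lemma act_add: "act V x (u + w) = act V x u + act V x w"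
  and act_scale: "act V x (mscale V c u) = mscale V c (act V x u)"
  and act_zero [simp]: "act V x 0 = 0"
  and act_diff: "act V x (u - w) = act V x u - act V x w"
  and act_sum: "act V x (\<Sum>i\<in>T. g i) = (\<Sum>i\<in>T. act V x (g i))"
proof -
  interpret l: Vector_Spaces.linear "mscale V" "mscale V" "act V x" by (rule linear_act)
  show "act V x (u + w) = act V x u + act V x w"
    "act V x (mscale V c u) = mscale V c (act V x u)" "act V x 0 = 0"
    "act V x (u - w) = act V x u - act V x w"
    "act V x (\<Sum>i\<in>T. g i) = (\<Sum>i\<in>T. act V x (g i))"
    by (simp_all add: l.add l.scale l.zero l.diff l.sum)
qed

lemma linear_act_left: "Vector_Spaces.linear (lscale L) (mscale V) (\<lambda>x. act V x u)"
  using lie_module by (simp add: lie_module_def)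

lemma act_add_left: "act V (x + y) u = act V x u + act V y u"
  and act_scale_left: "act V (lscale L c x) u = mscale V c (act V x u)"
  and act_zero_left [simp]: "act V 0 u = 0"
proof -
  interpret l: Vector_Spaces.linear "lscale L" "mscale V" "\<lambda>x. act V x u" by (rule linear_act_left)
  show "act V (x + y) u = act V x u + act V y u"
    "act V (lscale L c x) u = mscale V c (act V x u)" "act V 0 u = 0"
    by (simp_all add: l.add l.scale l.zero)
qed

lemma act_bracket: "act V (lbracket L x y) u = act V x (act V y u) - act V y (act V x u)"
  using lie_module by (simp add: lie_module_def)

lemma subspace_weight_space: "subspace (weight_space L V \<mu>)"
  by (rule subspaceI)
    (auto simp: weight_space_def act_add act_scale scale_right_distrib scale_left_commute)

lemma weight_spaceD: "u \<in> weight_space L V \<mu> \<Longrightarrow> h \<in> cartan L \<Longrightarrow> act V h u = mscale V (\<mu> h) u"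
  by (simp add: weight_space_def)

lemma act_root_space:
  assumes x: "x \<in> root_space L \<beta>" and u: "u \<in> weight_space L V \<mu>"
  shows "act V x u \<in> weight_space L V (\<mu> + \<beta>)"
  unfolding weight_space_def
proof safe
  fix h assume h: "h \<in> cartan L"
  have "act V (lbracket L h x) u = act V h (act V x u) - act V x (act V h u)"
    by (rule act_bracket)
  moreover have "lbracket L h x = lscale L (\<beta> h) x" using x h by (simp add: root_space_def)
  moreover have "act V h u = mscale V (\<mu> h) u" using u h by (rule weight_spaceD)
  ultimately show "act V h (act V x u) = mscale V ((\<mu> + \<beta>) h) (act V x u)"
    by (simp add: act_scale_left act_scale scale_left_distrib algebra_simps)
qed

lemma act_root_space_funpow:
  assumes x: "x \<in> root_space L \<beta>" and u: "u \<in> weight_space L V \<mu>"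
  shows "(act V x ^^ k) u \<in> weight_space L V (\<mu> + fscale (of_nat k) \<beta>)"
proof (induction k)
  case 0
  have "\<mu> + fscale (of_nat 0) \<beta> = \<mu>" by (simp add: fun_eq_iff)
  with u show ?case by simp
next
  case (Suc k)
  have "\<mu> + fscale (of_nat k) \<beta> + \<beta> = \<mu> + fscale (of_nat (Suc k)) \<beta>"
    by (simp add: fun_eq_iff algebra_simps)
  with act_root_space[OF x Suc] show ?case by (metis comp_apply funpow.simps(2))
qed

section \<open>Independence of weight spaces\<close>

lemma hdual_separated:
  "\<mu> \<in> hdual L \<Longrightarrow> \<nu> \<in> hdual L \<Longrightarrow> \<mu> \<noteq> \<nu> \<Longrightarrow> \<exists>h\<in>cartan L. \<mu> h \<noteq> \<nu> h"
proof (rule ccontr)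
  assume \<mu>: "\<mu> \<in> hdual L" and \<nu>: "\<nu> \<in> hdual L" and ne: "\<mu> \<noteq> \<nu>"
    and *: "\<not> (\<exists>h\<in>cartan L. \<mu> h \<noteq> \<nu> h)"
  have "\<mu> x = \<nu> x" for x
  proof (cases "x \<in> cartan L")
    case False
    then show ?thesis using \<mu> \<nu> by (simp add: hdual_def)
  qed (use * in blast)
  with ne show False by (simp add: fun_eq_iff)
qed

text \<open>The argument for eigenvectors, with the operator chosen for each pair of weights:
  \<open>h - \<nu>(h)\<close> kills the component at \<open>\<nu>\<close> and rescales the one at
  \<open>\<mu>\<close> by a nonzero factor. The induction ranges over all families \<open>u\<close>
  because it is applied to the rescaled family.\<close>

lemma weight_spaces_independent:
  assumes "finite T" "T \<subseteq> hdual L" "\<And>\<mu>. \<mu> \<in> T \<Longrightarrow> u \<mu> \<in> weight_space L V \<mu>" "(\<Sum>\<mu>\<in>T. u \<mu>) = 0"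
  shows "\<mu> \<in> T \<Longrightarrow> u \<mu> = 0"
  using assms
proof (induction T arbitrary: u \<mu> rule: finite_induct)
  case empty
  then show ?case by simp
next
  case (insert \<nu> T)
  have T: "u \<mu> = 0" if \<mu>: "\<mu> \<in> T" for \<mu>
  proof -
    have "\<mu> \<noteq> \<nu>" using \<mu> insert.hyps by auto
    then obtain h where h: "h \<in> cartan L" "\<mu> h \<noteq> \<nu> h"
      using hdual_separated[of \<mu> \<nu>] insert.prems \<mu> by auto
    let ?u = "\<lambda>\<mu>. mscale V (\<mu> h - \<nu> h) (u \<mu>)"
    have "(\<Sum>\<mu>\<in>insert \<nu> T. act V h (u \<mu>)) = 0"
      using insert.prems(4) by (metis act_sum act_zero)
    moreover have "(\<Sum>\<mu>\<in>insert \<nu> T. mscale V (\<nu> h) (u \<mu>)) = 0"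
      using insert.prems(4) by (metis scale_sum_right scale_zero_right)
    ultimately have "(\<Sum>\<mu>\<in>insert \<nu> T. act V h (u \<mu>) - mscale V (\<nu> h) (u \<mu>)) = 0"
      by (simp add: sum_subtractf)
    also have "(\<Sum>\<mu>\<in>insert \<nu> T. act V h (u \<mu>) - mscale V (\<nu> h) (u \<mu>)) = (\<Sum>\<mu>\<in>insert \<nu> T. ?u \<mu>)"
      using insert.prems(3) h
      by (intro sum.cong) (auto simp: weight_spaceD scale_left_diff_distrib)
    finally have "(\<Sum>\<mu>\<in>T. ?u \<mu>) = 0" using insert.hyps by simp
    moreover have "?u \<mu> \<in> weight_space L V \<mu>" if "\<mu> \<in> T" for \<mu>
      using insert.prems(3)[of \<mu>] that subspace_scale[OF subspace_weight_space] by auto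
    ultimately have "?u \<mu> = 0" using insert.IH[of \<mu> ?u] insert.prems(2) \<mu> by auto
    then show ?thesis using h by simp
  qed
  moreover have "u \<nu> = 0" using insert.prems(4) insert.hyps T by simp
  ultimately show ?case using insert.prems(1) by auto
qed

lemma span_weight_spaces_decompose:
  assumes "u \<in> span (\<Union>\<mu>\<in>A. weight_space L V \<mu>)"
  shows "\<exists>T f. finite T \<and> T \<subseteq> A \<and> (\<forall>\<mu>\<in>T. f \<mu> \<in> weight_space L V \<mu>) \<and> u = (\<Sum>\<mu>\<in>T. f \<mu>)"
  using assms
proof (induction rule: span_induct_alt)
  case base
  show ?case by (rule exI[of _ "{}"]) auto
next
  case (step c x y)
  then obtain T f where T: "finite T" "T \<subseteq> A" "\<forall>\<mu>\<in>T. f \<mu> \<in> weight_space L V \<mu>" "y = (\<Sum>\<mu>\<in>T. f \<mu>)"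
    by blast
  from step obtain \<nu> where \<nu>: "\<nu> \<in> A" "x \<in> weight_space L V \<nu>" by blast
  have cx: "mscale V c x \<in> weight_space L V \<nu>"
    using \<nu> subspace_scale[OF subspace_weight_space] by blast
  \<comment> \<open>The two summands treat the cases \<open>\<nu> \<in> T\<close> and
    \<open>\<nu> \<notin> T\<close> together.\<close>
  let ?f = "\<lambda>\<mu>. (if \<mu> = \<nu> then mscale V c x else 0) + (if \<mu> \<in> T then f \<mu> else 0)"
  have "mscale V c x + y = (\<Sum>\<mu>\<in>insert \<nu> T. ?f \<mu>)"
    using T(1) unfolding sum.distrib T(4)
    by (simp add: sum.delta sum.If_cases insert_absorb Int_absorb1 subset_insertI)
  moreover have "?f \<mu> \<in> weight_space L V \<mu>" for \<mu>
    using cx T(3) subspace_add[OF subspace_weight_space] subspace_0[OF subspace_weight_space] by simp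
  ultimately show ?case using T(1,2) \<nu>(1)
    by (intro exI[of _ "insert \<nu> T"] exI[of _ ?f]) auto
qed

text \<open>Moving \<open>u\<close> to the other side of its decomposition would give a vanishing
  sum with the nonzero component \<open>- u\<close> at a new weight. Through this fact a spanning
  set controls which weights occur, both for the adjoint representation and for
  \<open>V\<close>.\<close>

lemma weight_of_span:
  assumes A: "A \<subseteq> hdual L" and span: "u \<in> span (\<Union>\<mu>\<in>A. weight_space L V \<mu>)"
    and u: "u \<in> weight_space L V \<nu>" "u \<noteq> 0" and \<nu>: "\<nu> \<in> hdual L"
  shows "\<nu> \<in> A"
proof (rule ccontr)
  assume "\<nu> \<notin> A"
  obtain T f where T: "finite T" "T \<subseteq> A" "\<forall>\<mu>\<in>T. f \<mu> \<in> weight_space L V \<mu>" "u = (\<Sum>\<mu>\<in>T. f \<mu>)"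
    using span_weight_spaces_decompose[OF span] by blast
  have nT: "\<nu> \<notin> T" using \<open>\<nu> \<notin> A\<close> T by auto
  let ?f = "f(\<nu> := - u)"
  have "(\<Sum>\<mu>\<in>insert \<nu> T. ?f \<mu>) = - u + (\<Sum>\<mu>\<in>T. ?f \<mu>)" using T(1) nT by simp
  also have "(\<Sum>\<mu>\<in>T. ?f \<mu>) = u" unfolding T(4) using nT by (intro sum.cong) auto
  finally have "(\<Sum>\<mu>\<in>insert \<nu> T. ?f \<mu>) = 0" by simp
  then have "?f \<nu> = 0"
    using T A \<nu> u subspace_neg[OF subspace_weight_space]
    by (intro weight_spaces_independent[of "insert \<nu> T" ?f]) auto
  with u show False by simp
qed

text \<open>Lets stability of a subspace be checked on the Chevalley generators alone, as they
  generate the whole Lie algebra.\<close>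

lemma subalgebra_stabilizer:
  assumes N: "subspace N"
  shows "lie_subalgebra L {x. \<forall>u\<in>N. act V x u \<in> N}"
proof -
  interpret l: vector_space "lscale L" using lie_algebra by (simp add: lie_algebra_def)
  show ?thesis
    unfolding lie_subalgebra_def
    using subspace_0[OF N] subspace_add[OF N] subspace_scale[OF N] subspace_diff[OF N]
    by (auto intro!: l.subspaceI simp: act_add_left act_scale_left act_bracket)
qed

end

section \<open>The adjoint representation\<close>

definition ad_rep :: "('g, 'b) lie_alg_scheme \<Rightarrow> ('g, 'g) lie_rep" where
  "ad_rep L = \<lparr>mscale = lscale L, act = lbracket L\<rparr>"

lemma ad_rep_simps [simp]: "mscale (ad_rep L) = lscale L" "act (ad_rep L) = lbracket L"
  by (simp_all add: ad_rep_def)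

lemma lie_algebra_antisym:
  assumes "lie_algebra L"
  shows "lbracket L x y = - lbracket L y x"
proof -
  have "Vector_Spaces.linear (lscale L) (lscale L) (lbracket L z)"
    and "Vector_Spaces.linear (lscale L) (lscale L) (\<lambda>x. lbracket L x z)"
    and alt: "lbracket L z z = 0" for z
    using assms by (auto simp: lie_algebra_def)
  then have add: "lbracket L z (x + y) = lbracket L z x + lbracket L z y"
    "lbracket L (x + y) z = lbracket L x z + lbracket L y z" for z
    by (auto simp: Vector_Spaces.linear_iff)
  have "lbracket L (x + y) (x + y) = lbracket L x y + lbracket L y x"
    unfolding add by (simp add: alt add.commute)
  then show ?thesis by (simp add: alt eq_neg_iff_add_eq_0)
qed

lemma lie_module_ad_rep:
  assumes "lie_algebra L"
  shows "lie_module L (ad_rep L)"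
proof -
  have jac: "lbracket L x (lbracket L y z) + lbracket L y (lbracket L z x)
                + lbracket L z (lbracket L x y) = 0" for x y z
    using assms unfolding lie_algebra_def by blast
  have neg: "lbracket L x (- y) = - lbracket L x y" for x y
  proof -
    interpret l: Vector_Spaces.linear "lscale L" "lscale L" "lbracket L x"
      using assms by (simp add: lie_algebra_def)
    show ?thesis by (rule l.neg)
  qed
  have "lbracket L (lbracket L x y) z
      = lbracket L x (lbracket L y z) - lbracket L y (lbracket L x z)" for x y z
  proof -
    have "lbracket L z (lbracket L x y) = lbracket L y (lbracket L x z) - lbracket L x (lbracket L y z)"
      using jac[of x y z] unfolding lie_algebra_antisym[OF assms, of z x] neg
      by (simp add: algebra_simps)
    then show ?thesis using lie_algebra_antisym[OF assms, of "lbracket L x y" z] by simp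
  qed
  with assms show ?thesis by (simp add: lie_module_def lie_algebra_def)
qed

sublocale semisimple_chevalley \<subseteq> ad: lie_rep_on L "ad_rep L"
  rewrites "mscale (ad_rep L) = lscale L" and "act (ad_rep L) = lbracket L"
    and "weight_space L (ad_rep L) = root_space L"
proof -
  show "lie_rep_on L (ad_rep L)"
    using lie_algebra lie_module_ad_rep by unfold_locales auto
  show "weight_space L (ad_rep L) = root_space L"
    by (rule ext) (simp add: weight_space_def root_space_def)
qed simp_all

context semisimple_chevalley
begin

lemma ad_antisym: "lbracket L x y = - lbracket L y x"
  by (rule lie_algebra_antisym[OF lie_algebra])

lemma fin_dim_basis: obtains B where "finite_dimensional_vector_space (lscale L) B"
  using fin_dim by (auto simp: fin_dim_def)

lemma cartan_subspace: "ad.subspace (cartan L)"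
  using cartan by (simp add: cartan_subalgebra_def toral_def lie_subalgebra_def)

lemmas cartan_0 = ad.subspace_0[OF cartan_subspace]
  and cartan_add = ad.subspace_add[OF cartan_subspace]
  and cartan_scale = ad.subspace_scale[OF cartan_subspace]
  and cartan_diff = ad.subspace_diff[OF cartan_subspace]
  and cartan_sum = ad.subspace_sum[OF cartan_subspace]

lemma cartan_commute: "h \<in> cartan L \<Longrightarrow> h' \<in> cartan L \<Longrightarrow> lbracket L h h' = 0"
  using cartan by (simp add: cartan_subalgebra_def toral_def)

lemma hdual_cartan:
  assumes "\<nu> \<in> hdual L"
  shows hdual_app_add: "x \<in> cartan L \<Longrightarrow> y \<in> cartan L \<Longrightarrow> \<nu> (x + y) = \<nu> x + \<nu> y"
    and hdual_app_scale: "x \<in> cartan L \<Longrightarrow> \<nu> (lscale L c x) = c * \<nu> x"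
  using assms by (auto simp: hdual_def)

lemma hdual_app_0: "\<nu> \<in> hdual L \<Longrightarrow> \<nu> 0 = 0"
  using hdual_app_scale[of \<nu> 0 0] cartan_0 by simp

lemma hdual_app_sum:
  assumes "\<nu> \<in> hdual L" "\<And>i. i \<in> T \<Longrightarrow> f i \<in> cartan L"
  shows "\<nu> (\<Sum>i\<in>T. f i) = (\<Sum>i\<in>T. \<nu> (f i))"
  using assms(2)
proof (induction T rule: infinite_finite_induct)
  case (insert x F)
  then show ?case by (simp add: hdual_app_add[OF assms(1)] cartan_sum)
qed (simp_all add: hdual_app_0[OF assms(1)])

lemma hdual_subspace: "module.subspace fscale (hdual L)"
proof -
  interpret fs: vector_space fscale by (rule vector_space_fscale)
  show ?thesis by (rule fs.subspaceI) (auto simp: hdual_def algebra_simps)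
qed

lemma hdual_0: "0 \<in> hdual L"
  and hdual_add: "\<mu> \<in> hdual L \<Longrightarrow> \<nu> \<in> hdual L \<Longrightarrow> \<mu> + \<nu> \<in> hdual L"
  and hdual_diff: "\<mu> \<in> hdual L \<Longrightarrow> \<nu> \<in> hdual L \<Longrightarrow> \<mu> - \<nu> \<in> hdual L"
  and hdual_neg: "\<mu> \<in> hdual L \<Longrightarrow> - \<mu> \<in> hdual L"
  and hdual_scale: "\<mu> \<in> hdual L \<Longrightarrow> fscale c \<mu> \<in> hdual L"
  and hdual_sum: "(\<And>x. x \<in> T \<Longrightarrow> f x \<in> hdual L) \<Longrightarrow> sum f T \<in> hdual L"
proof -
  interpret fs: vector_space fscale by (rule vector_space_fscale)
  show "0 \<in> hdual L" by (rule fs.subspace_0[OF hdual_subspace])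
  show "\<mu> + \<nu> \<in> hdual L" if "\<mu> \<in> hdual L" "\<nu> \<in> hdual L"
    using that by (rule fs.subspace_add[OF hdual_subspace])
  show "\<mu> - \<nu> \<in> hdual L" if "\<mu> \<in> hdual L" "\<nu> \<in> hdual L"
    using that by (rule fs.subspace_diff[OF hdual_subspace])
  show "- \<mu> \<in> hdual L" if "\<mu> \<in> hdual L"
    using that by (rule fs.subspace_neg[OF hdual_subspace])
  show "fscale c \<mu> \<in> hdual L" if "\<mu> \<in> hdual L"
    using that by (rule fs.subspace_scale[OF hdual_subspace])
  show "sum f T \<in> hdual L" if "\<And>x. x \<in> T \<Longrightarrow> f x \<in> hdual L"
    using that by (rule fs.subspace_sum[OF hdual_subspace])
qed

section \<open>Simple roots\<close>

lemma finite_nodes [simp]: "finite (nodes L)"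
  and inj_sroot: "inj_on (sroot L) (nodes L)"
  and sroot_roots: "i \<in> nodes L \<Longrightarrow> sroot L i \<in> roots L"
  using root_base by (auto simp: root_base_def)

lemma roots_hdual: "\<beta> \<in> roots L \<Longrightarrow> \<beta> \<in> hdual L"
  by (simp add: roots_def)

lemma sroot_hdual: "i \<in> nodes L \<Longrightarrow> sroot L i \<in> hdual L"
  by (simp add: roots_hdual sroot_roots)

lemma sroot_independent:
  assumes "(\<Sum>i\<in>nodes L. fscale (a i) (sroot L i)) = 0" "j \<in> nodes L"
  shows "a j = 0"
proof -
  interpret fs: vector_space fscale by (rule vector_space_fscale)
  let ?g = "inv_into (nodes L) (sroot L)"
  have "(\<Sum>\<beta>\<in>sroot L ` nodes L. fscale (a (?g \<beta>)) \<beta>) = (\<Sum>i\<in>nodes L. fscale (a i) (sroot L i))"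
    by (subst sum.reindex[OF inj_sroot]) (simp add: inj_sroot)
  also have "\<dots> = 0" by (rule assms)
  finally have "a (?g (sroot L j)) = 0"
    using assms(2) root_base
    by (intro fs.independentD[of "sroot L ` nodes L" "sroot L ` nodes L" "\<lambda>\<beta>. a (?g \<beta>)"])
      (auto simp: root_base_def)
  then show ?thesis using assms(2) by (simp add: inj_sroot)
qed

lemma hdual_expand:
  assumes "\<nu> \<in> hdual L"
  obtains a where "\<nu> = (\<Sum>i\<in>nodes L. fscale (a i) (sroot L i))"
proof -
  interpret fs: vector_space fscale by (rule vector_space_fscale)
  have "\<nu> \<in> fs.span (sroot L ` nodes L)" using assms root_base by (simp add: root_base_def)
  then obtain u where "\<nu> = (\<Sum>\<beta>\<in>sroot L ` nodes L. fscale (u \<beta>) \<beta>)"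
    by (auto simp: fs.span_finite)
  then have "\<nu> = (\<Sum>i\<in>nodes L. fscale (u (sroot L i)) (sroot L i))"
    by (simp add: sum.reindex[OF inj_sroot])
  then show thesis by (rule that)
qed

lemma cartan_separated:
  assumes t: "t \<in> cartan L" and 0: "\<And>i. i \<in> nodes L \<Longrightarrow> sroot L i t = 0"
  shows "t = 0"
proof (rule ccontr)
  assume "t \<noteq> 0"
  interpret P: vector_space_pair "lscale L" "(*) :: complex \<Rightarrow> complex \<Rightarrow> complex"
    by unfold_locales (simp_all add: algebra_simps)
  have "ad.independent {t}" using \<open>t \<noteq> 0\<close> by simp
  from P.linear_independent_extend[OF this, of "\<lambda>_. 1"] obtain g
    where g: "Vector_Spaces.linear (lscale L) (*) g" "g t = 1" by auto
  \<comment> \<open>The extension is cut off outside the Cartan subalgebra because elements of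
    \<open>hdual L\<close> vanish there by convention.\<close>
  let ?\<nu> = "\<lambda>x. if x \<in> cartan L then g x else 0"
  have "?\<nu> \<in> hdual L"
    using g(1) by (auto simp: hdual_def Vector_Spaces.linear_iff cartan_add cartan_scale)
  then obtain a where "?\<nu> = (\<Sum>i\<in>nodes L. fscale (a i) (sroot L i))" by (rule hdual_expand)
  from fun_cong[OF this, of t] have "?\<nu> t = (\<Sum>i\<in>nodes L. a i * sroot L i t)"
    by (simp add: sum_fun_apply)
  with t g(2) 0 show False by simp
qed

section \<open>Root decomposition and Killing form\<close>

lemma triangular_decompose:
  "\<exists>p h m. x = p + h + m \<and> h \<in> cartan L \<and>
     p \<in> ad.span (\<Union>\<beta>\<in>pos_roots L. root_space L \<beta>) \<and>
     m \<in> ad.span (\<Union>\<beta>\<in>uminus ` pos_roots L. root_space L \<beta>)"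
proof -
  have "\<exists>!(p, h, m). p \<in> nplus L \<and> h \<in> cartan L \<and> m \<in> nminus L \<and> x = p + h + m"
    using triangular by (simp add: triangular_decomposition_def)
  then obtain p h m where "p \<in> nplus L" "h \<in> cartan L" "m \<in> nminus L" "x = p + h + m" by auto
  then show ?thesis unfolding nplus_def nminus_def by auto
qed

lemma pos_roots_roots: "\<beta> \<in> pos_roots L \<Longrightarrow> \<beta> \<in> roots L"
  by (simp add: pos_roots_def)

text \<open>The Cartan subalgebra is its own centralizer: subtracting the Cartan component of x in
  the triangular decomposition leaves a vector of weight 0 in a sum of root spaces of nonzero
  weight, hence 0.\<close>

lemma root_space_0: "root_space L 0 = cartan L"
proof
  show "cartan L \<subseteq> root_space L 0" by (auto simp: root_space_def cartan_commute)
  show "root_space L 0 \<subseteq> cartan L"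
  proof
    fix x assume x: "x \<in> root_space L 0"
    obtain p h m where phm: "x = p + h + m" "h \<in> cartan L"
      "p \<in> ad.span (\<Union>\<beta>\<in>pos_roots L. root_space L \<beta>)"
      "m \<in> ad.span (\<Union>\<beta>\<in>uminus ` pos_roots L. root_space L \<beta>)"
      using triangular_decompose by blast
    let ?A = "pos_roots L \<union> uminus ` pos_roots L"
    have "p \<in> ad.span (\<Union>\<beta>\<in>?A. root_space L \<beta>)" "m \<in> ad.span (\<Union>\<beta>\<in>?A. root_space L \<beta>)"
      using phm(3,4) ad.span_mono[of _ "\<Union>\<beta>\<in>?A. root_space L \<beta>"] by blast+
    then have "x - h \<in> ad.span (\<Union>\<beta>\<in>?A. root_space L \<beta>)"
      using phm(1) by (simp add: algebra_simps ad.span_add)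
    moreover have "?A \<subseteq> hdual L" by (auto intro: hdual_neg roots_hdual dest: pos_roots_roots)
    moreover have "x - h \<in> root_space L 0"
      using x \<open>cartan L \<subseteq> root_space L 0\<close> phm(2) ad.subspace_diff[OF ad.subspace_weight_space]
      by blast
    moreover have "0 \<notin> ?A" by (auto simp: pos_roots_def roots_def)
    ultimately have "x - h = 0" using ad.weight_of_span hdual_0 by blast
    with phm(2) show "x \<in> cartan L" by simp
  qed
qed

section \<open>A basis of root vectors and the trace formula for the Killing form\<close>

lemma span_root_spaces: "ad.span (\<Union>\<beta>\<in>hdual L. root_space L \<beta>) = UNIV"
proof -
  have "x \<in> ad.span (\<Union>\<beta>\<in>hdual L. root_space L \<beta>)" for x
  proof -
    obtain p h m where phm: "x = p + h + m" "h \<in> cartan L"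
      "p \<in> ad.span (\<Union>\<beta>\<in>pos_roots L. root_space L \<beta>)"
      "m \<in> ad.span (\<Union>\<beta>\<in>uminus ` pos_roots L. root_space L \<beta>)"
      using triangular_decompose by blast
    have "pos_roots L \<subseteq> hdual L" "uminus ` pos_roots L \<subseteq> hdual L"
      by (auto intro: hdual_neg roots_hdual dest: pos_roots_roots)
    then have "p \<in> ad.span (\<Union>\<beta>\<in>hdual L. root_space L \<beta>)"
      "m \<in> ad.span (\<Union>\<beta>\<in>hdual L. root_space L \<beta>)"
      using phm(3,4) ad.span_mono[of _ "\<Union>\<beta>\<in>hdual L. root_space L \<beta>"]
      by (meson UN_mono order_refl subsetD)+
    moreover have "h \<in> ad.span (\<Union>\<beta>\<in>hdual L. root_space L \<beta>)"
      using phm(2) hdual_0 root_space_0 by (intro ad.span_base) auto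
    ultimately show ?thesis unfolding phm(1) by (intro ad.span_add)
  qed
  then show ?thesis by auto
qed

text \<open>The roots, together with 0 when the Cartan subalgebra is nonzero; so the set indexes the
  full weight decomposition of the adjoint representation. The zero weight contributes nothing to
  the Killing form on the Cartan subalgebra.\<close>

definition ad_weights :: "('g \<Rightarrow> complex) set" where
  "ad_weights = {\<beta> \<in> hdual L. root_space L \<beta> \<noteq> {0}}"

lemma roots_ad_weights: "\<beta> \<in> roots L \<Longrightarrow> \<beta> \<in> ad_weights"
  and ad_weights_hdual: "\<beta> \<in> ad_weights \<Longrightarrow> \<beta> \<in> hdual L"
  by (auto simp: ad_weights_def roots_def)

lemma ad_weights_cases: "\<beta> \<in> ad_weights \<Longrightarrow> \<beta> = 0 \<or> \<beta> \<in> roots L"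
  by (auto simp: ad_weights_def roots_def)

text \<open>A maximal independent set of root vectors is a basis because root vectors span. No
  weight is missed, since a nonzero vector in the span of the other root spaces cannot have the
  missing weight.\<close>

lemma root_vector_basis:
  obtains B w where "finite_dimensional_vector_space (lscale L) B"
    "\<And>b. b \<in> B \<Longrightarrow> b \<in> root_space L (w b)" "w ` B = ad_weights"
proof -
  obtain B where B: "B \<subseteq> (\<Union>\<beta>\<in>hdual L. root_space L \<beta>)" "ad.independent B"
    "(\<Union>\<beta>\<in>hdual L. root_space L \<beta>) \<subseteq> ad.span B"
    using ad.maximal_independent_subset by blast
  have sp: "ad.span B = UNIV"
    using ad.span_mono[OF B(3)] by (simp add: span_root_spaces ad.span_span top.extremum_unique)
  obtain B0 where "finite_dimensional_vector_space (lscale L) B0" by (rule fin_dim_basis)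
  then interpret fd: finite_dimensional_vector_space "lscale L" B0 .
  have fB: "finite B" using B(2) by (rule fd.finiteI_independent)
  have fdB: "finite_dimensional_vector_space (lscale L) B"
    using fB sp B(2) by unfold_locales
  have "\<forall>b\<in>B. \<exists>\<beta>. \<beta> \<in> hdual L \<and> b \<in> root_space L \<beta>" using B(1) by blast
  then obtain w where w: "\<And>b. b \<in> B \<Longrightarrow> w b \<in> hdual L \<and> b \<in> root_space L (w b)" by metis
  have "0 \<notin> B" using B(2) ad.dependent_zero by blast
  then have "w ` B \<subseteq> ad_weights" unfolding ad_weights_def using w by fastforce
  moreover have "\<beta> \<in> w ` B" if \<beta>: "\<beta> \<in> ad_weights" for \<beta>
  proof -
    obtain x where x: "x \<in> root_space L \<beta>" "x \<noteq> 0"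
      using \<beta> ad.subspace_0[OF ad.subspace_weight_space, of \<beta>] unfolding ad_weights_def by blast
    have "B \<subseteq> (\<Union>\<mu>\<in>w ` B. root_space L \<mu>)" using w by blast
    then have "x \<in> ad.span (\<Union>\<mu>\<in>w ` B. root_space L \<mu>)" using ad.span_mono sp by blast
    then show ?thesis using ad.weight_of_span[of "w ` B" x \<beta>] w x \<beta> ad_weights_hdual by blast
  qed
  ultimately have "w ` B = ad_weights" by blast
  with that fdB w show thesis by blast
qed

lemma finite_ad_weights: "finite ad_weights"
proof -
  obtain B w where "finite_dimensional_vector_space (lscale L) B" "w ` B = ad_weights"
    by (rule root_vector_basis) blast
  then show ?thesis by (metis finite_imageI finite_dimensional_vector_space.finite_Basis)
qed

text \<open>The product of two Cartan elements in the adjoint representation is diagonal in a basis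
  of root vectors. The number \<open>m \<beta>\<close> counts the basis vectors of weight
  \<open>\<beta>\<close>; later arguments use only that it is positive.\<close>

lemma killing_cartan:
  obtains m :: "('g \<Rightarrow> complex) \<Rightarrow> nat"
  where "\<And>\<beta>. \<beta> \<in> ad_weights \<Longrightarrow> m \<beta> > 0"
    "\<And>h h'. h \<in> cartan L \<Longrightarrow> h' \<in> cartan L \<Longrightarrow>
       killing L h h' = (\<Sum>\<beta>\<in>ad_weights. of_nat (m \<beta>) * (\<beta> h * \<beta> h'))"
proof -
  obtain B w where B: "finite_dimensional_vector_space (lscale L) B"
    and w: "\<And>b. b \<in> B \<Longrightarrow> b \<in> root_space L (w b)" "w ` B = ad_weights"
    by (rule root_vector_basis) blast
  interpret fd: finite_dimensional_vector_space "lscale L" B by (fact B)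
  define m where "m \<beta> = card {b \<in> B. w b = \<beta>}" for \<beta>
  have "m \<beta> > 0" if "\<beta> \<in> ad_weights" for \<beta>
    unfolding m_def using that[folded w(2)] fd.finite_Basis by (subst card_gt_0_iff) auto
  moreover have "killing L h h' = (\<Sum>\<beta>\<in>ad_weights. of_nat (m \<beta>) * (\<beta> h * \<beta> h'))"
    if h: "h \<in> cartan L" "h' \<in> cartan L" for h h'
  proof -
    have rep: "ad.representation B (lbracket L h (lbracket L h' b)) b = w b h * w b h'"
      if b: "b \<in> B" for b
    proof -
      have "lbracket L h (lbracket L h' b) = lscale L (w b h * w b h') b"
        using w(1)[OF b] h by (simp add: ad.weight_spaceD ad.act_scale mult.commute)
      then show ?thesis
        using b by (simp add: ad.representation_scale ad.representation_basis fd.independent_Basis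
            fd.span_Basis)
    qed
    have "killing L h h'
        = (\<Sum>b\<in>B. ad.representation B (lbracket L h (lbracket L h' b)) b)"
      unfolding killing_def
      by (subst lin_trace_basis[OF B])
        (auto intro!: Vector_Spaces.linear_compose ad.linear_act)
    also have "\<dots> = (\<Sum>b\<in>B. w b h * w b h')" by (rule sum.cong) (simp_all add: rep)
    also have "\<dots> = (\<Sum>\<beta>\<in>ad_weights. \<Sum>b\<in>{b \<in> B. w b = \<beta>}. w b h * w b h')"
      unfolding w(2)[symmetric] by (rule sum.image_gen[OF fd.finite_Basis])
    also have "\<dots> = (\<Sum>\<beta>\<in>ad_weights. of_nat (m \<beta>) * (\<beta> h * \<beta> h'))"
      by (rule sum.cong) (simp_all add: m_def)
    finally show ?thesis .
  qed
  ultimately show thesis using that by blast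
qed

lemma killing_cartan_sym:
  "h \<in> cartan L \<Longrightarrow> h' \<in> cartan L \<Longrightarrow> killing L h h' = killing L h' h"
  by (rule killing_cartan) (simp add: mult.commute)

lemma killing_cartan_hdual:
  assumes "t \<in> cartan L"
  shows "(\<lambda>h. if h \<in> cartan L then killing L t h else 0) \<in> hdual L"
proof -
  obtain m :: "('g \<Rightarrow> complex) \<Rightarrow> nat" where
    m: "\<And>h h'. h \<in> cartan L \<Longrightarrow> h' \<in> cartan L \<Longrightarrow>
       killing L h h' = (\<Sum>\<beta>\<in>ad_weights. of_nat (m \<beta>) * (\<beta> h * \<beta> h'))"
    by (rule killing_cartan) blast
  have "(\<lambda>h. if h \<in> cartan L then killing L t h else 0)
      = (\<lambda>h. if h \<in> cartan L then (\<Sum>\<beta>\<in>ad_weights. of_nat (m \<beta>) * (\<beta> t * \<beta> h)) else 0)"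
    using m[OF assms] by (simp add: fun_eq_iff)
  also have "\<dots> = (\<Sum>\<beta>\<in>ad_weights. fscale (of_nat (m \<beta>) * \<beta> t) \<beta>)"
    using ad_weights_hdual
    by (auto simp: fun_eq_iff sum_fun_apply hdual_def mult.assoc intro!: sum.neutral)
  also have "\<dots> \<in> hdual L" by (intro hdual_sum hdual_scale ad_weights_hdual)
  finally show ?thesis .
qed

text \<open>Expand the bracket into two products of three operators; the trace allows the leading
  \<open>ad y\<close> of the second to be moved to its end.\<close>

lemma killing_invariant:
  "killing L (lbracket L x y) z = killing L x (lbracket L y z)"
proof -
  obtain B where B: "finite_dimensional_vector_space (lscale L) B" by (rule fin_dim_basis)
  note lin = ad.linear_act Vector_Spaces.linear_compose[of "lscale L" "lscale L" _ "lscale L"]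
  let ?a = "lbracket L"
  have "killing L (?a x y) z
      = lin_trace (lscale L) (\<lambda>u. (?a x \<circ> (?a y \<circ> ?a z)) u - (?a y \<circ> (?a x \<circ> ?a z)) u)"
    unfolding killing_def by (rule arg_cong[where f = "lin_trace _"]) (auto simp: ad.act_bracket)
  also have "\<dots> = lin_trace (lscale L) (?a x \<circ> (?a y \<circ> ?a z)) - lin_trace (lscale L) (?a y \<circ> (?a x \<circ> ?a z))"
    by (intro lin_trace_diff[OF B] lin)
  also have "lin_trace (lscale L) (?a y \<circ> (?a x \<circ> ?a z)) = lin_trace (lscale L) ((?a x \<circ> ?a z) \<circ> ?a y)"
    by (intro lin_trace_commute[OF B] lin)
  also have "lin_trace (lscale L) (?a x \<circ> (?a y \<circ> ?a z)) - lin_trace (lscale L) ((?a x \<circ> ?a z) \<circ> ?a y)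
      = lin_trace (lscale L) (\<lambda>u. (?a x \<circ> (?a y \<circ> ?a z)) u - ((?a x \<circ> ?a z) \<circ> ?a y) u)"
    by (intro lin_trace_diff[OF B, symmetric] lin)
  also have "\<dots> = killing L x (?a y z)"
    unfolding killing_def
    by (rule arg_cong[where f = "lin_trace _"]) (auto simp: ad.act_bracket ad.act_diff)
  finally show ?thesis .
qed

section \<open>Coroots\<close>

lemma xplus_root: "i \<in> nodes L \<Longrightarrow> xplus L i \<in> root_space L (sroot L i)"
  and xminus_root: "i \<in> nodes L \<Longrightarrow> xminus L i \<in> root_space L (- sroot L i)"
  and sroot_coroot: "i \<in> nodes L \<Longrightarrow> sroot L i (coroot L i) = 2"
  and bracket_xplus_xminus:
    "i \<in> nodes L \<Longrightarrow> j \<in> nodes L \<Longrightarrow> i \<noteq> j \<Longrightarrow> lbracket L (xplus L i) (xminus L j) = 0"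
  using chevalley by (auto simp: chevalley_generators_def)

lemma generated:
  "lie_subalgebra L A \<Longrightarrow> (\<And>i. i \<in> nodes L \<Longrightarrow> xplus L i \<in> A) \<Longrightarrow>
    (\<And>i. i \<in> nodes L \<Longrightarrow> xminus L i \<in> A) \<Longrightarrow> x \<in> A"
  using chevalley unfolding chevalley_generators_def by blast

lemma coroot_cartan: "i \<in> nodes L \<Longrightarrow> coroot L i \<in> cartan L"
  using ad.act_root_space[OF xplus_root xminus_root, of i i] by (simp add: coroot_def root_space_0)

lemma xplus_nonzero: "i \<in> nodes L \<Longrightarrow> xplus L i \<noteq> 0"
  using sroot_coroot[of i] hdual_app_0[OF sroot_hdual, of i] by (auto simp: coroot_def)

text \<open>On a root vector of weight \<open>\<mu>\<close> nonzero powers would produce the weights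
  \<open>\<mu> + p \<beta>\<close>, pairwise distinct, while only finitely many adjoint weights
  exist. The vectors killed by some power form a subspace, and root vectors span.\<close>

lemma ad_locally_nilpotent:
  assumes \<beta>: "\<beta> \<in> hdual L" "\<beta> \<noteq> 0" and x: "x \<in> root_space L \<beta>"
  shows "\<exists>p. (lbracket L x ^^ p) y = 0"
proof -
  let ?N = "{y. \<exists>p. (lbracket L x ^^ p) y = 0}"
  have up: "(lbracket L x ^^ q) y = 0" if "(lbracket L x ^^ p) y = 0" "p \<le> q" for p q y
  proof -
    have "(lbracket L x ^^ q) y = (lbracket L x ^^ (q - p)) ((lbracket L x ^^ p) y)"
      using that(2) by (simp flip: funpow_add comp_apply[of "_ ^^ _"])
    moreover have "(lbracket L x ^^ n) 0 = 0" for n by (induction n) auto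
    ultimately show ?thesis using that(1) by simp
  qed
  have add: "(lbracket L x ^^ p) (y + z) = (lbracket L x ^^ p) y + (lbracket L x ^^ p) z" for p y z
    by (induction p) (auto simp: ad.act_add)
  have scale: "(lbracket L x ^^ p) (lscale L c y) = lscale L c ((lbracket L x ^^ p) y)" for p y c
    by (induction p) (auto simp: ad.act_scale)
  have "ad.subspace ?N"
  proof (rule ad.subspaceI)
    show "0 \<in> ?N" by (auto intro: exI[of _ 0])
    fix y z c assume "y \<in> ?N"
    then obtain p where p: "(lbracket L x ^^ p) y = 0" by blast
    then show "lscale L c y \<in> ?N" by (auto simp: scale intro: exI[of _ p])
    assume "z \<in> ?N"
    then obtain q where q: "(lbracket L x ^^ q) z = 0" by blast
    have "(lbracket L x ^^ max p q) (y + z) = 0" using up[OF p] up[OF q] by (simp add: add)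
    then show "y + z \<in> ?N" by blast
  qed
  moreover have "z \<in> ?N" if \<mu>: "\<mu> \<in> hdual L" and z: "z \<in> root_space L \<mu>" for \<mu> z
  proof (rule ccontr)
    assume *: "z \<notin> ?N"
    let ?f = "\<lambda>p. \<mu> + fscale (of_nat p) \<beta>"
    have "?f p \<in> ad_weights" for p
      using ad.act_root_space_funpow[OF x z, of p] * \<mu> \<beta>
      by (auto simp: ad_weights_def intro!: hdual_add hdual_scale)
    then have "range ?f \<subseteq> ad_weights" by auto
    then have "finite (range ?f)" using finite_ad_weights by (rule finite_subset)
    moreover have "inj ?f"
    proof (rule injI)
      fix p q assume eq: "?f p = ?f q"
      obtain h where "\<beta> h \<noteq> 0" using \<beta>(2) by (auto simp: fun_eq_iff)
      then show "p = q" using fun_cong[OF eq, of h] by simp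
    qed
    ultimately show False by (simp add: finite_image_iff)
  qed
  ultimately have "ad.span (\<Union>\<beta>\<in>hdual L. root_space L \<beta>) \<subseteq> ?N"
    by (intro ad.span_minimal) auto
  then show ?thesis by (auto simp: span_root_spaces)
qed

lemma sroot_nonzero: "i \<in> nodes L \<Longrightarrow> sroot L i \<noteq> 0"
  using sroot_roots[of i] by (simp add: roots_def)

lemma xplus_locally_nilpotent: "i \<in> nodes L \<Longrightarrow> \<exists>p. (lbracket L (xplus L i) ^^ p) y = 0"
  by (rule ad_locally_nilpotent[OF sroot_hdual sroot_nonzero xplus_root])

lemma xminus_locally_nilpotent: "i \<in> nodes L \<Longrightarrow> \<exists>p. (lbracket L (xminus L i) ^^ p) y = 0"
  using hdual_neg[OF sroot_hdual, of i] sroot_nonzero[of i]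
  by (intro ad_locally_nilpotent[OF _ _ xminus_root]) auto

text \<open>For distinct nodes \<open>xplus L i\<close> is killed by \<open>xminus L j\<close>, so
  it is a highest weight vector for the triple with raising and lowering operators exchanged. Its
  weight there is the negative of the Cartan entry.\<close>

lemma cartan_matrix_nonpos:
  assumes i: "i \<in> nodes L" and j: "j \<in> nodes L" and ne: "i \<noteq> j"
  shows "\<exists>n. sroot L i (coroot L j) = - of_nat n"
proof -
  let ?E = "lbracket L (xminus L j)" and ?F = "lbracket L (xplus L j)"
  let ?H = "\<lambda>w. - lbracket L (coroot L j) w"
  have comm: "?E (?F w) - ?F (?E w) = ?H w" for w
    by (simp add: coroot_def ad.act_bracket)
  have H: "?H ((?F ^^ k) (xplus L i))
      = lscale L (- sroot L i (coroot L j) - 2 * of_nat k) ((?F ^^ k) (xplus L i))" for k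
    using ad.weight_spaceD[OF ad.act_root_space_funpow[OF xplus_root[OF j] xplus_root[OF i]]
        coroot_cartan[OF j], of k]
    by (simp add: sroot_coroot[OF j] flip: ad.scale_minus_left)
  have E: "?E (xplus L i) = 0"
    using bracket_xplus_xminus[OF i j ne] ad_antisym[of "xminus L j"] by simp
  obtain p where "(?F ^^ p) (xplus L i) = 0" using xplus_locally_nilpotent[OF j] by blast
  from sl2_highest_weight_nat[OF ad.linear_act ad.linear_act comm H E xplus_nonzero[OF i] this]
  obtain n where "- sroot L i (coroot L j) = of_nat n" by blast
  then show ?thesis by (metis minus_minus)
qed

lemma cartan_matrix_Ints:
  assumes "i \<in> nodes L" "j \<in> nodes L"
  shows "sroot L i (coroot L j) \<in> \<int>"
  using cartan_matrix_nonpos[OF assms] sroot_coroot[of i] assms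
  by (cases "i = j") (auto simp: Ints_minus)

lemma zplus_D: "\<beta> \<in> zplus L K \<Longrightarrow> \<exists>c. \<beta> = (\<Sum>j\<in>K. fscale (of_nat (c j)) (sroot L j))"
  by (auto simp: zplus_def)

lemma ad_weight_coroot_Ints:
  assumes "\<beta> \<in> ad_weights" "j \<in> nodes L"
  shows "\<beta> (coroot L j) \<in> \<int>"
proof -
  have *: "\<gamma> (coroot L j) \<in> \<int>" if "\<gamma> \<in> zplus L (nodes L)" for \<gamma>
    using zplus_D[OF that] cartan_matrix_Ints assms(2)
    by (auto simp: sum_fun_apply intro!: Ints_sum Ints_mult)
  from ad_weights_cases[OF assms(1)] show ?thesis
  proof
    assume "\<beta> \<in> roots L"
    then have "\<beta> \<in> zplus L (nodes L) \<or> - \<beta> \<in> zplus L (nodes L)"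
      using root_base by (simp add: root_base_def)
    then show ?thesis using *[of \<beta>] *[of "- \<beta>"] by (auto simp: minus_in_Ints_iff)
  qed simp
qed

section \<open>The form on the dual of the Cartan subalgebra\<close>

lemma killing_scale_right: "killing L x (lscale L c y) = c * killing L x y"
proof -
  obtain B where B: "finite_dimensional_vector_space (lscale L) B" by (rule fin_dim_basis)
  interpret fd: finite_dimensional_vector_space "lscale L" B by (fact B)
  have lin: "Vector_Spaces.linear (lscale L) (lscale L) (lbracket L u \<circ> lbracket L z)" for u z
    by (rule Vector_Spaces.linear_compose[OF ad.linear_act ad.linear_act])
  show ?thesis
    unfolding killing_def lin_trace_basis[OF B lin]
    by (simp add: ad.act_scale_left ad.act_scale ad.representation_scale fd.independent_Basis
        fd.span_Basis sum_distrib_left)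
qed

text \<open>Invariance gives \<open>killing L (coroot L i) h\<close> as the constant c times
  \<open>sroot L i h\<close>. At the coroot itself this reads 2c, while the trace formula gives a
  sum of squares of integers with positive weights, in which the term of the simple root is
  positive.\<close>

lemma killing_xplus_xminus_pos:
  assumes i: "i \<in> nodes L"
  obtains c where "c > 0" "killing L (xplus L i) (xminus L i) = complex_of_real c"
    "\<And>h. h \<in> cartan L \<Longrightarrow> killing L (coroot L i) h = complex_of_real c * sroot L i h"
proof -
  let ?c = "killing L (xplus L i) (xminus L i)"
  have inv: "killing L (coroot L i) h = ?c * sroot L i h" if h: "h \<in> cartan L" for h
  proof -
    have "lbracket L (xminus L i) h = lscale L (sroot L i h) (xminus L i)"
      using ad.weight_spaceD[OF xminus_root[OF i] h] ad_antisym[of "xminus L i" h] by simp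
    then show ?thesis
      unfolding coroot_def killing_invariant by (simp add: killing_scale_right mult.commute)
  qed
  obtain m :: "('g \<Rightarrow> complex) \<Rightarrow> nat" where
    m: "\<And>\<beta>. \<beta> \<in> ad_weights \<Longrightarrow> m \<beta> > 0" "\<And>h h'. h \<in> cartan L \<Longrightarrow> h' \<in> cartan L \<Longrightarrow>
       killing L h h' = (\<Sum>\<beta>\<in>ad_weights. of_nat (m \<beta>) * (\<beta> h * \<beta> h'))"
    by (rule killing_cartan) blast
  define r where "r \<beta> = real (m \<beta>) * (Re (\<beta> (coroot L i)))\<^sup>2" for \<beta>
  have "killing L (coroot L i) (coroot L i) = (\<Sum>\<beta>\<in>ad_weights. complex_of_real (r \<beta>))"
    unfolding m(2)[OF coroot_cartan[OF i] coroot_cartan[OF i]]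
  proof (rule sum.cong)
    fix \<beta> assume "\<beta> \<in> ad_weights"
    then have "\<beta> (coroot L i) \<in> \<int>" using i by (rule ad_weight_coroot_Ints)
    then obtain z where "\<beta> (coroot L i) = of_int z" by (rule Ints_cases)
    then show "of_nat (m \<beta>) * (\<beta> (coroot L i) * \<beta> (coroot L i)) = complex_of_real (r \<beta>)"
      by (simp add: r_def power2_eq_square)
  qed simp
  also have "\<dots> = complex_of_real (\<Sum>\<beta>\<in>ad_weights. r \<beta>)" by simp
  finally have eq: "?c * 2 = complex_of_real (\<Sum>\<beta>\<in>ad_weights. r \<beta>)"
    using inv[OF coroot_cartan[OF i]] i by (simp add: sroot_coroot)
  have "0 < (\<Sum>\<beta>\<in>ad_weights. r \<beta>)"
  proof (rule sum_pos2[OF finite_ad_weights])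
    show "sroot L i \<in> ad_weights" using i by (intro roots_ad_weights sroot_roots)
    then show "0 < r (sroot L i)" using m(1) i by (simp add: r_def sroot_coroot)
  qed (simp add: r_def)
  moreover have "?c = complex_of_real ((\<Sum>\<beta>\<in>ad_weights. r \<beta>) / 2)" using eq by simp
  ultimately show thesis using that[of "(\<Sum>\<beta>\<in>ad_weights. r \<beta>) / 2"] inv by simp
qed

text \<open>\<open>coroot_scale i\<close> is half the square length of the simple root \<open>\<alpha>\<^sub>i\<close>.\<close>

definition coroot_scale :: "'i \<Rightarrow> real" where
  "coroot_scale i = 1 / Re (killing L (xplus L i) (xminus L i))"

lemma coroot_scale_pos: "i \<in> nodes L \<Longrightarrow> coroot_scale i > 0"
  by (rule killing_xplus_xminus_pos) (auto simp: coroot_scale_def)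

text \<open>Identifies \<open>coroot_scale i\<close> times the coroot as the element dual to the
  simple root.\<close>

lemma killing_coroot:
  assumes "i \<in> nodes L" "h \<in> cartan L"
  shows "of_real (coroot_scale i) * killing L (coroot L i) h = sroot L i h"
  using assms(1) by (rule killing_xplus_xminus_pos) (use assms(2) in \<open>auto simp: coroot_scale_def\<close>)

lemma killing_left_scale:
  assumes "t \<in> cartan L" "h \<in> cartan L"
  shows "killing L (lscale L c t) h = c * killing L t h"
  using hdual_app_scale[OF killing_cartan_hdual[OF assms(2)] assms(1), of c] assms
  by (simp add: killing_cartan_sym[of _ h] cartan_scale)

lemma killing_left_add:
  assumes "t \<in> cartan L" "t' \<in> cartan L" "h \<in> cartan L"
  shows "killing L (t + t') h = killing L t h + killing L t' h"
  using hdual_app_add[OF killing_cartan_hdual[OF assms(3)] assms(1,2)] assms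
  by (simp add: killing_cartan_sym[of _ h] cartan_add)

lemma killing_left_sum:
  assumes "\<And>i. i \<in> T \<Longrightarrow> f i \<in> cartan L" "h \<in> cartan L"
  shows "killing L (\<Sum>i\<in>T. f i) h = (\<Sum>i\<in>T. killing L (f i) h)"
proof -
  have "killing L h (\<Sum>i\<in>T. f i) = (\<Sum>i\<in>T. killing L h (f i))"
    using hdual_app_sum[OF killing_cartan_hdual[OF assms(2)], of T f] assms(1) by (simp add: cartan_sum)
  then show ?thesis using assms by (simp add: killing_cartan_sym[of _ h] cartan_sum)
qed

text \<open>Orthogonality to the coroots already means that all simple roots vanish at
  \<open>t\<close>.\<close>

lemma killing_nondegenerate:
  assumes "t \<in> cartan L" "\<And>h. h \<in> cartan L \<Longrightarrow> killing L t h = 0"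
  shows "t = 0"
proof (rule cartan_separated[OF assms(1)])
  fix i assume i: "i \<in> nodes L"
  show "sroot L i t = 0"
    using killing_coroot[OF i assms(1)] assms coroot_cartan[OF i]
    by (simp add: killing_cartan_sym[of _ t])
qed

lemma dual_elem_unique:
  assumes "t \<in> cartan L" "\<And>h. h \<in> cartan L \<Longrightarrow> killing L t h = \<nu> h"
  shows "dual_elem L \<nu> = t"
  unfolding dual_elem_def
proof (rule the_equality)
  fix s assume s: "s \<in> cartan L \<and> (\<forall>h\<in>cartan L. killing L s h = \<nu> h)"
  have "s - t = 0"
  proof (rule killing_nondegenerate)
    show "s - t \<in> cartan L" using s assms(1) cartan_diff by blast
    fix h assume h: "h \<in> cartan L"
    have "killing L (s - t + t) h = killing L (s - t) h + killing L t h"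
      using s assms(1) h by (intro killing_left_add cartan_diff) auto
    then show "killing L (s - t) h = 0" using s h assms(2) by simp
  qed
  then show "s = t" by simp
qed (use assms in auto)

lemma dual_elem_sroot_sum:
  "dual_elem L (\<Sum>i\<in>nodes L. fscale (a i) (sroot L i))
    = (\<Sum>i\<in>nodes L. lscale L (a i * of_real (coroot_scale i)) (coroot L i))"
proof (rule dual_elem_unique)
  show "(\<Sum>i\<in>nodes L. lscale L (a i * of_real (coroot_scale i)) (coroot L i)) \<in> cartan L"
    by (intro cartan_sum cartan_scale coroot_cartan)
  fix h assume h: "h \<in> cartan L"
  show "killing L (\<Sum>i\<in>nodes L. lscale L (a i * of_real (coroot_scale i)) (coroot L i)) h
      = (\<Sum>i\<in>nodes L. fscale (a i) (sroot L i)) h"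
    using h by (simp add: killing_left_sum killing_left_scale cartan_scale coroot_cartan sum_fun_apply
        mult.assoc killing_coroot)
qed

lemma dual_elem:
  assumes "\<nu> \<in> hdual L"
  shows dual_elem_cartan: "dual_elem L \<nu> \<in> cartan L"
    and killing_dual_elem: "h \<in> cartan L \<Longrightarrow> killing L (dual_elem L \<nu>) h = \<nu> h"
proof -
  obtain a where a: "\<nu> = (\<Sum>i\<in>nodes L. fscale (a i) (sroot L i))"
    using assms by (rule hdual_expand)
  show "dual_elem L \<nu> \<in> cartan L"
    unfolding a dual_elem_sroot_sum by (intro cartan_sum cartan_scale coroot_cartan)
  show "killing L (dual_elem L \<nu>) h = \<nu> h" if "h \<in> cartan L"
    unfolding a dual_elem_sroot_sum using that
    by (simp add: killing_left_sum killing_left_scale cartan_scale coroot_cartan sum_fun_apply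
        mult.assoc killing_coroot)
qed

lemma hform_eq: "\<mu> \<in> hdual L \<Longrightarrow> \<nu> \<in> hdual L \<Longrightarrow> hform L \<mu> \<nu> = \<mu> (dual_elem L \<nu>)"
  by (simp add: hform_def dual_elem)

lemma hform_sym: "\<mu> \<in> hdual L \<Longrightarrow> \<nu> \<in> hdual L \<Longrightarrow> hform L \<mu> \<nu> = hform L \<nu> \<mu>"
  unfolding hform_def by (intro killing_cartan_sym dual_elem_cartan)

lemma hform_sroot_sum:
  assumes "\<nu> \<in> hdual L"
  shows "hform L \<nu> (\<Sum>i\<in>nodes L. fscale (a i) (sroot L i))
    = (\<Sum>i\<in>nodes L. a i * of_real (coroot_scale i) * \<nu> (coroot L i))"
proof -
  have "(\<Sum>i\<in>nodes L. fscale (a i) (sroot L i)) \<in> hdual L"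
    by (intro hdual_sum hdual_scale sroot_hdual)
  with assms show ?thesis
    by (simp add: hform_eq dual_elem_sroot_sum hdual_app_sum hdual_app_scale cartan_scale coroot_cartan)
qed

lemma hform_add_left:
  "\<mu> \<in> hdual L \<Longrightarrow> \<mu>' \<in> hdual L \<Longrightarrow> \<nu> \<in> hdual L \<Longrightarrow> hform L (\<mu> + \<mu>') \<nu> = hform L \<mu> \<nu> + hform L \<mu>' \<nu>"
  by (simp add: hform_eq hdual_add)

lemma hform_diff_left:
  "\<mu> \<in> hdual L \<Longrightarrow> \<mu>' \<in> hdual L \<Longrightarrow> \<nu> \<in> hdual L \<Longrightarrow> hform L (\<mu> - \<mu>') \<nu> = hform L \<mu> \<nu> - hform L \<mu>' \<nu>"
  by (simp add: hform_eq hdual_diff)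

lemma hform_scale_left:
  "\<mu> \<in> hdual L \<Longrightarrow> \<nu> \<in> hdual L \<Longrightarrow> hform L (fscale c \<mu>) \<nu> = c * hform L \<mu> \<nu>"
  by (simp add: hform_eq hdual_scale)

lemma hform_diff_right:
  "\<nu> \<in> hdual L \<Longrightarrow> \<mu> \<in> hdual L \<Longrightarrow> \<mu>' \<in> hdual L \<Longrightarrow> hform L \<nu> (\<mu> - \<mu>') = hform L \<nu> \<mu> - hform L \<nu> \<mu>'"
  by (simp add: hform_sym[of \<nu>] hform_diff_left hdual_diff)

section \<open>Weyl group and fundamental weights\<close>

lemma root_reflection_hdual:
  assumes "\<beta> \<in> hdual L" "\<nu> \<in> hdual L"
  shows "root_reflection L \<beta> \<nu> \<in> hdual L"
  unfolding root_reflection_def using assms by (intro hdual_diff hdual_scale)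

lemma root_reflection_add:
  assumes "\<beta> \<in> hdual L" "\<mu> \<in> hdual L" "\<nu> \<in> hdual L"
  shows "root_reflection L \<beta> (\<mu> + \<nu>) = root_reflection L \<beta> \<mu> + root_reflection L \<beta> \<nu>"
  unfolding root_reflection_def using assms
  by (simp add: hform_add_left fun_eq_iff add_divide_distrib algebra_simps)

text \<open>If \<open>(\<beta>, \<beta>) = 0\<close>, division by zero makes the reflection the identity.\<close>

lemma root_reflection_involution:
  assumes \<beta>: "\<beta> \<in> hdual L" and \<nu>: "\<nu> \<in> hdual L"
  shows "root_reflection L \<beta> (root_reflection L \<beta> \<nu>) = \<nu>"
proof (cases "hform L \<beta> \<beta> = 0")
  case True
  then show ?thesis by (simp add: root_reflection_def fun_eq_iff)
next
  case False
  then have "hform L (root_reflection L \<beta> \<nu>) \<beta> = - hform L \<nu> \<beta>"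
    using assms by (simp add: root_reflection_def hform_diff_left hform_scale_left hdual_scale)
  then show ?thesis
    unfolding root_reflection_def[of L \<beta> "root_reflection L \<beta> \<nu>"]
    by (simp add: root_reflection_def[of L \<beta> \<nu>] fun_eq_iff)
qed

text \<open>Exactly what is needed to transport cardinalities and sums of weights along
  \<open>w\<close>. All properties are restricted to \<open>hdual L\<close>, where reflections act
  as intended.\<close>

lemma weyl_group_additive:
  assumes "w \<in> weyl_group L"
  shows "w ` hdual L \<subseteq> hdual L \<and> inj_on w (hdual L) \<and> w 0 = 0 \<and>
    (\<forall>\<mu>\<in>hdual L. \<forall>\<nu>\<in>hdual L. w (\<mu> + \<nu>) = w \<mu> + w \<nu>)"
  using assms
proof induction
  case (weyl_reflection \<beta> w)
  then have \<beta>: "\<beta> \<in> hdual L" by (simp add: roots_hdual)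
  have "inj_on (root_reflection L \<beta>) (hdual L)"
    by (rule inj_on_inverseI) (rule root_reflection_involution[OF \<beta>])
  moreover have "root_reflection L \<beta> 0 = 0"
    using root_reflection_add[OF \<beta> hdual_0 hdual_0] by simp
  ultimately show ?case
    using weyl_reflection.IH root_reflection_hdual[OF \<beta>] root_reflection_add[OF \<beta>]
      comp_inj_on[of w "hdual L" "root_reflection L \<beta>"]
      inj_on_subset[of "root_reflection L \<beta>" "hdual L" "w ` hdual L"]
    unfolding comp_apply image_comp[symmetric] image_subset_iff by metis
qed auto

text \<open>For infinite \<open>X\<close> both sums are 0 by convention, and \<open>w 0 = 0\<close>
  covers that case as well as the empty one.\<close>

lemma weyl_group_sum:
  assumes w: "w \<in> weyl_group L" and X: "X \<subseteq> hdual L"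
  shows "w (\<Sum>x\<in>X. x) = (\<Sum>x\<in>X. w x)"
  using X
proof (induction X rule: infinite_finite_induct)
  case (insert x F)
  then have "(\<Sum>x\<in>F. x) \<in> hdual L" by (intro hdual_sum) auto
  then have "w (x + (\<Sum>x\<in>F. x)) = w x + w (\<Sum>x\<in>F. x)"
    using weyl_group_additive[OF w] insert.prems by blast
  with insert show ?case by (simp only: sum.insert insert_subset simp_thms)
qed (use weyl_group_additive[OF w] in auto)

section \<open>Coroots as a basis of the Cartan subalgebra, fundamental weights as the dual
  basis\<close>

lemma cartan_coroot_expand:
  assumes "t \<in> cartan L"
  obtains a where "t = (\<Sum>i\<in>nodes L. lscale L (a i) (coroot L i))"
proof -
  let ?\<nu> = "\<lambda>h. if h \<in> cartan L then killing L t h else 0"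
  \<comment> \<open>The element \<open>t\<close> is dual to the functional it defines through the
    Killing form. Expanding that functional in simple roots and dualizing back expresses
    \<open>t\<close> by coroots.\<close>
  obtain a where a: "?\<nu> = (\<Sum>i\<in>nodes L. fscale (a i) (sroot L i))"
    using killing_cartan_hdual[OF assms] by (rule hdual_expand)
  have "dual_elem L ?\<nu> = t" by (rule dual_elem_unique) (use assms in auto)
  then show thesis using that unfolding a dual_elem_sroot_sum by metis
qed

lemma hdual_eqI:
  assumes "\<mu> \<in> hdual L" "\<nu> \<in> hdual L" "\<And>i. i \<in> nodes L \<Longrightarrow> \<mu> (coroot L i) = \<nu> (coroot L i)"
  shows "\<mu> = \<nu>"
proof
  fix h
  show "\<mu> h = \<nu> h"
  proof (cases "h \<in> cartan L")
    case True
    then obtain a where "h = (\<Sum>i\<in>nodes L. lscale L (a i) (coroot L i))"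
      by (rule cartan_coroot_expand)
    then show ?thesis using assms
      by (simp add: hdual_app_sum hdual_app_scale cartan_scale coroot_cartan)
  qed (use assms in \<open>simp add: hdual_def\<close>)
qed

lemma coroot_independent:
  assumes "(\<Sum>i\<in>nodes L. lscale L (a i) (coroot L i)) = 0" "j \<in> nodes L"
  shows "a j = 0"
proof -
  \<comment> \<open>The division cancels the factor \<open>coroot_scale i\<close> that dualizing a
    simple root produces.\<close>
  let ?b = "\<lambda>i. a i / of_real (coroot_scale i)"
  let ?\<nu> = "\<Sum>i\<in>nodes L. fscale (?b i) (sroot L i)"
  have \<nu>: "?\<nu> \<in> hdual L" by (intro hdual_sum hdual_scale sroot_hdual)
  have "dual_elem L ?\<nu> = (\<Sum>i\<in>nodes L. lscale L (a i) (coroot L i))"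
    unfolding dual_elem_sroot_sum using coroot_scale_pos by (intro sum.cong) force+
  then have "dual_elem L ?\<nu> = 0" using assms(1) by simp
  then have "?\<nu> h = 0" if "h \<in> cartan L" for h
    using killing_dual_elem[OF \<nu> that] killing_left_scale[OF cartan_0 that, of 0] by simp
  then have "?\<nu> = 0" using \<nu> hdual_0 by (intro hdual_eqI) (auto simp: coroot_cartan)
  from sroot_independent[OF this assms(2)] show ?thesis using coroot_scale_pos[OF assms(2)] by simp
qed

lemma inj_coroot: "inj_on (coroot L) (nodes L)"
proof (rule inj_onI, rule ccontr)
  fix i j assume *: "i \<in> nodes L" "j \<in> nodes L" "coroot L i = coroot L j" "i \<noteq> j"
  let ?a = "(\<lambda>_. 0)(i := 1, j := - 1 :: complex)"
  have "(\<Sum>k\<in>nodes L. lscale L (?a k) (coroot L k)) = (\<Sum>k\<in>{i, j}. lscale L (?a k) (coroot L k))"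
    using * by (intro sum.mono_neutral_right) auto
  also have "\<dots> = 0" using * by simp
  finally show False using coroot_independent[of ?a j] * by simp
qed

lemma fund_weight_exists:
  "\<exists>\<omega>. \<omega> \<in> hdual L \<and> (\<forall>j\<in>nodes L. \<omega> (coroot L j) = (if i = j then 1 else 0))"
proof -
  interpret P: vector_space_pair "lscale L" "(*) :: complex \<Rightarrow> complex \<Rightarrow> complex"
    by unfold_locales (simp_all add: algebra_simps)
  have ind: "ad.independent (coroot L ` nodes L)"
  proof (rule ad.independent_if_scalars_zero)
    fix f x assume 0: "(\<Sum>y\<in>coroot L ` nodes L. lscale L (f y) y) = 0" and x: "x \<in> coroot L ` nodes L"
    from 0 have "(\<Sum>k\<in>nodes L. lscale L (f (coroot L k)) (coroot L k)) = 0"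
      by (simp add: sum.reindex[OF inj_coroot])
    with x show "f x = 0" using coroot_independent[of "\<lambda>k. f (coroot L k)"] by auto
  qed simp
  from P.linear_independent_extend[OF this, of "\<lambda>h. if h = coroot L i then 1 else 0"] obtain g
    where g: "Vector_Spaces.linear (lscale L) (*) g"
      "\<And>j. j \<in> nodes L \<Longrightarrow> g (coroot L j) = (if coroot L j = coroot L i then 1 else 0)" by auto
  \<comment> \<open>For an index outside the nodes the zero functional satisfies the condition, so
    \<open>fund_weight\<close> is well defined at every index.\<close>
  let ?\<nu> = "\<lambda>x. if x \<in> cartan L \<and> i \<in> nodes L then g x else 0"
  have "?\<nu> \<in> hdual L"
    using g(1) by (auto simp: hdual_def Vector_Spaces.linear_iff cartan_add cartan_scale)
  moreover have "?\<nu> (coroot L j) = (if i = j then 1 else 0)" if "j \<in> nodes L" for j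
    using g(2)[OF that] that coroot_cartan[OF that] inj_onD[OF inj_coroot, of i j] by auto
  ultimately show ?thesis by blast
qed

lemma fund_weight:
  shows fund_weight_hdual: "fund_weight L i \<in> hdual L"
    and fund_weight_coroot: "j \<in> nodes L \<Longrightarrow> fund_weight L i (coroot L j) = (if i = j then 1 else 0)"
proof -
  have "\<exists>!\<omega>. \<omega> \<in> hdual L \<and> (\<forall>j\<in>nodes L. \<omega> (coroot L j) = (if i = j then 1 else 0))"
    by (rule ex_ex1I[OF fund_weight_exists]) (auto intro!: hdual_eqI)
  from theI'[OF this, folded fund_weight_def]
  show "fund_weight L i \<in> hdual L"
    "j \<in> nodes L \<Longrightarrow> fund_weight L i (coroot L j) = (if i = j then 1 else 0)" by auto
qed

lemma rho_nodes:
  assumes "K \<subseteq> nodes L"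
  shows rho_nodes_hdual: "rho_nodes L K \<in> hdual L"
    and rho_nodes_coroot: "j \<in> nodes L \<Longrightarrow> rho_nodes L K (coroot L j) = (if j \<in> K then 1 else 0)"
  using finite_subset[OF assms finite_nodes]
  by (auto simp: rho_nodes_def sum_fun_apply fund_weight_coroot intro!: hdual_sum fund_weight_hdual)

lemma proj:
  assumes "K \<subseteq> nodes L"
  shows proj_hdual: "proj L K \<nu> \<in> hdual L"
    and proj_coroot: "j \<in> K \<Longrightarrow> proj L K \<nu> (coroot L j) = \<nu> (coroot L j)"
proof -
  have K: "finite K" using finite_subset[OF assms finite_nodes] .
  show "proj L K \<nu> \<in> hdual L"
    unfolding proj_def by (intro hdual_sum hdual_scale fund_weight_hdual)
  assume j: "j \<in> K"
  have "proj L K \<nu> (coroot L j) = (\<Sum>k\<in>K. if k = j then \<nu> (coroot L k) else 0)"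
    unfolding proj_def using j assms by (auto simp: sum_fun_apply fund_weight_coroot intro!: sum.cong)
  also have "\<dots> = \<nu> (coroot L j)" using j K by simp
  finally show "proj L K \<nu> (coroot L j) = \<nu> (coroot L j)" .
qed

section \<open>The positive root cone\<close>

text \<open>The coordinate of \<open>\<gamma>\<close> at the i-th simple root: pairing with the
  fundamental weight isolates that coordinate up to the factor \<open>coroot_scale i\<close>. As a
  formula it is visibly linear in \<open>\<gamma>\<close>.\<close>

definition coeff :: "('g \<Rightarrow> complex) \<Rightarrow> 'i \<Rightarrow> complex" where
  "coeff \<gamma> i = hform L \<gamma> (fund_weight L i) / of_real (coroot_scale i)"

lemma coeff_add: "\<gamma> \<in> hdual L \<Longrightarrow> \<delta> \<in> hdual L \<Longrightarrow> coeff (\<gamma> + \<delta>) i = coeff \<gamma> i + coeff \<delta> i"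
  and coeff_diff: "\<gamma> \<in> hdual L \<Longrightarrow> \<delta> \<in> hdual L \<Longrightarrow> coeff (\<gamma> - \<delta>) i = coeff \<gamma> i - coeff \<delta> i"
  and coeff_scale: "\<gamma> \<in> hdual L \<Longrightarrow> coeff (fscale c \<gamma>) i = c * coeff \<gamma> i"
  by (simp_all add: coeff_def hform_add_left hform_diff_left hform_scale_left fund_weight_hdual
      add_divide_distrib diff_divide_distrib)

lemma coeff_sroot_sum:
  assumes "i \<in> nodes L"
  shows "coeff (\<Sum>k\<in>nodes L. fscale (a k) (sroot L k)) i = a i"
proof -
  have "(\<Sum>k\<in>nodes L. fscale (a k) (sroot L k)) \<in> hdual L"
    by (intro hdual_sum hdual_scale sroot_hdual)
  then have "coeff (\<Sum>k\<in>nodes L. fscale (a k) (sroot L k)) i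
      = (\<Sum>k\<in>nodes L. a k * of_real (coroot_scale k) * (if i = k then 1 else 0))
          / of_real (coroot_scale i)"
    unfolding coeff_def
    by (subst hform_sym) (simp_all add: fund_weight_hdual hform_sroot_sum fund_weight_coroot)
  also have "(\<Sum>k\<in>nodes L. a k * of_real (coroot_scale k) * (if i = k then 1 else 0))
      = (\<Sum>k\<in>nodes L. if i = k then a k * of_real (coroot_scale k) else (0::complex))"
    by (intro sum.cong) auto
  also have "\<dots> / of_real (coroot_scale i) = a i" using assms coroot_scale_pos[OF assms] by simp
  finally show ?thesis .
qed

lemma coeff_expand:
  assumes "\<gamma> \<in> hdual L"
  shows "\<gamma> = (\<Sum>i\<in>nodes L. fscale (coeff \<gamma> i) (sroot L i))"
proof -
  obtain a where a: "\<gamma> = (\<Sum>i\<in>nodes L. fscale (a i) (sroot L i))" using assms by (rule hdual_expand)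
  have "(\<Sum>i\<in>nodes L. fscale (coeff \<gamma> i) (sroot L i)) = (\<Sum>i\<in>nodes L. fscale (a i) (sroot L i))"
    unfolding a by (rule sum.cong) (simp_all add: coeff_sroot_sum)
  with a show ?thesis by simp
qed

lemma hdual_apply_coeff:
  assumes "\<gamma> \<in> hdual L"
  shows "\<gamma> h = (\<Sum>i\<in>nodes L. coeff \<gamma> i * sroot L i h)"
  by (subst coeff_expand[OF assms]) (simp add: sum_fun_apply)

lemma coeff_sroot:
  assumes "i \<in> nodes L" "j \<in> nodes L"
  shows "coeff (sroot L j) i = (if i = j then 1 else 0)"
proof -
  have "sroot L j = (\<Sum>k\<in>nodes L. if k = j then sroot L j else 0)" using assms(2) by simp
  also have "\<dots> = (\<Sum>k\<in>nodes L. fscale (if k = j then 1 else 0) (sroot L k))"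
    by (intro sum.cong) (auto simp: fun_eq_iff)
  finally show ?thesis using coeff_sroot_sum[OF assms(1), of "\<lambda>k. if k = j then 1 else 0"] by simp
qed

lemma hform_coeff:
  assumes "\<nu> \<in> hdual L" "\<gamma> \<in> hdual L"
  shows "hform L \<nu> \<gamma> = (\<Sum>i\<in>nodes L. coeff \<gamma> i * of_real (coroot_scale i) * \<nu> (coroot L i))"
  by (subst coeff_expand[OF assms(2)]) (rule hform_sroot_sum[OF assms(1)])

lemma hform_sroot:
  assumes "\<nu> \<in> hdual L" "j \<in> nodes L"
  shows "hform L \<nu> (sroot L j) = of_real (coroot_scale j) * \<nu> (coroot L j)"
proof -
  have "hform L \<nu> (sroot L j)
      = (\<Sum>i\<in>nodes L. if i = j then of_real (coroot_scale i) * \<nu> (coroot L i) else 0)"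
    unfolding hform_coeff[OF assms(1) sroot_hdual[OF assms(2)]]
    by (intro sum.cong) (use assms in \<open>auto simp: coeff_sroot\<close>)
  then show ?thesis using assms(2) by simp
qed

text \<open>Replaces the existential quantifier over combinations by conditions on unique
  coordinates; supports of combinations can then be compared.\<close>

lemma zplus_iff:
  assumes K: "K \<subseteq> nodes L"
  shows "\<beta> \<in> zplus L K \<longleftrightarrow> \<beta> \<in> hdual L \<and> (\<forall>i\<in>nodes L. coeff \<beta> i \<in> \<nat>) \<and> (\<forall>i\<in>nodes L - K. coeff \<beta> i = 0)"
proof
  assume "\<beta> \<in> zplus L K"
  then obtain c where c: "\<beta> = (\<Sum>j\<in>K. fscale (of_nat (c j)) (sroot L j))" using zplus_D by blast
  let ?c = "\<lambda>i. of_nat (if i \<in> K then c i else 0)"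
  have *: "\<beta> = (\<Sum>i\<in>nodes L. fscale (?c i) (sroot L i))"
    unfolding c using K by (intro sum.mono_neutral_cong_left) (auto simp: fun_eq_iff)
  moreover have "\<beta> \<in> hdual L" unfolding * by (intro hdual_sum hdual_scale sroot_hdual)
  moreover have "coeff \<beta> i = ?c i" if "i \<in> nodes L" for i unfolding * by (rule coeff_sroot_sum[OF that])
  ultimately show "\<beta> \<in> hdual L \<and> (\<forall>i\<in>nodes L. coeff \<beta> i \<in> \<nat>) \<and> (\<forall>i\<in>nodes L - K. coeff \<beta> i = 0)"
    by auto
next
  assume *: "\<beta> \<in> hdual L \<and> (\<forall>i\<in>nodes L. coeff \<beta> i \<in> \<nat>) \<and> (\<forall>i\<in>nodes L - K. coeff \<beta> i = 0)"
  then have "\<forall>i\<in>nodes L. \<exists>n. coeff \<beta> i = of_nat n" by (auto simp: Nats_def)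
  then obtain c where c: "\<And>i. i \<in> nodes L \<Longrightarrow> coeff \<beta> i = of_nat (c i)" by metis
  have "(\<Sum>i\<in>nodes L. fscale (coeff \<beta> i) (sroot L i)) = (\<Sum>i\<in>K. fscale (of_nat (c i)) (sroot L i))"
    using K * c by (intro sum.mono_neutral_cong_right) (auto simp: fun_eq_iff)
  then have "\<beta> = (\<Sum>i\<in>K. fscale (of_nat (c i)) (sroot L i))" using coeff_expand[of \<beta>] * by simp
  then show "\<beta> \<in> zplus L K" unfolding zplus_def by blast
qed

lemma zplus_mono:
  assumes "J \<subseteq> K" "K \<subseteq> nodes L"
  shows "zplus L J \<subseteq> zplus L K"
  using zplus_iff[OF order_trans[OF assms]] zplus_iff[OF assms(2)] assms(1) by blast

lemma zplus_add_sroot: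
  "K \<subseteq> nodes L \<Longrightarrow> \<beta> \<in> zplus L K \<Longrightarrow> j \<in> K \<Longrightarrow> \<beta> + sroot L j \<in> zplus L K"
  by (auto simp: zplus_iff coeff_add coeff_sroot sroot_hdual subsetD intro!: hdual_add)

text \<open>The Killing form is positive definite on the real span of the coroots.\<close>

lemma hform_self_lower_bound:
  assumes \<gamma>: "\<gamma> \<in> hdual L" and real: "\<And>i. i \<in> nodes L \<Longrightarrow> \<gamma> (coroot L i) \<in> \<real>"
  obtains R where "hform L \<gamma> \<gamma> = complex_of_real R"
    "(\<Sum>i\<in>nodes L. (coroot_scale i * Re (\<gamma> (coroot L i)))\<^sup>2) \<le> R"
proof -
  let ?t = "dual_elem L \<gamma>"
  have t: "?t \<in> cartan L" by (rule dual_elem_cartan[OF \<gamma>])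
  have \<alpha>: "sroot L i ?t = of_real (coroot_scale i) * \<gamma> (coroot L i)" if "i \<in> nodes L" for i
    using hform_sroot[OF \<gamma> that] hform_sym[OF \<gamma> sroot_hdual[OF that]] hform_eq[OF sroot_hdual[OF that] \<gamma>]
    by simp
  \<comment> \<open>Every root is, up to sign, a natural combination of simple roots, and these are
    real at the dual element.\<close>
  have \<beta>_real: "\<beta> ?t \<in> \<real>" if \<beta>: "\<beta> \<in> ad_weights" for \<beta>
  proof -
    have *: "\<delta> ?t \<in> \<real>" if \<delta>: "\<delta> \<in> zplus L (nodes L)" for \<delta>
    proof -
      have "\<delta> ?t = (\<Sum>i\<in>nodes L. coeff \<delta> i * sroot L i ?t)"
        using \<delta> zplus_iff[OF order_refl] hdual_apply_coeff by blast
      also have "\<dots> \<in> \<real>"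
        using \<delta> real unfolding zplus_iff[OF order_refl]
        by (intro sum_in_Reals Reals_mult) (auto simp: \<alpha> elim!: Nats_cases dest!: bspec)
      finally show ?thesis .
    qed
    from ad_weights_cases[OF \<beta>] show ?thesis
    proof
      assume "\<beta> \<in> roots L"
      then have "\<beta> \<in> zplus L (nodes L) \<or> - \<beta> \<in> zplus L (nodes L)"
        using root_base by (simp add: root_base_def)
      then show ?thesis using *[of \<beta>] *[of "- \<beta>"] by auto
    qed simp
  qed
  obtain m :: "('g \<Rightarrow> complex) \<Rightarrow> nat" where
    m: "\<And>\<beta>. \<beta> \<in> ad_weights \<Longrightarrow> m \<beta> > 0" "\<And>h h'. h \<in> cartan L \<Longrightarrow> h' \<in> cartan L \<Longrightarrow>
       killing L h h' = (\<Sum>\<beta>\<in>ad_weights. of_nat (m \<beta>) * (\<beta> h * \<beta> h'))"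
    by (rule killing_cartan) blast
  define r where "r \<beta> = real (m \<beta>) * (Re (\<beta> ?t))\<^sup>2" for \<beta>
  have "hform L \<gamma> \<gamma> = (\<Sum>\<beta>\<in>ad_weights. complex_of_real (r \<beta>))"
    unfolding hform_def m(2)[OF t t]
    by (rule sum.cong)
      (auto simp: r_def power2_eq_square dest!: \<beta>_real elim!: Reals_cases)
  then have 1: "hform L \<gamma> \<gamma> = complex_of_real (\<Sum>\<beta>\<in>ad_weights. r \<beta>)" by simp
  \<comment> \<open>Of the sum of squares over all adjoint weights only the simple roots are kept,
    each with multiplicity at least 1.\<close>
  have "(\<Sum>i\<in>nodes L. (coroot_scale i * Re (\<gamma> (coroot L i)))\<^sup>2) \<le> (\<Sum>i\<in>nodes L. r (sroot L i))"
  proof (rule sum_mono)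
    fix i assume i: "i \<in> nodes L"
    then have "1 \<le> real (m (sroot L i))" using m(1)[of "sroot L i"] roots_ad_weights sroot_roots by fastforce
    then show "(coroot_scale i * Re (\<gamma> (coroot L i)))\<^sup>2 \<le> r (sroot L i)"
      unfolding r_def \<alpha>[OF i] using mult_right_mono[of 1 "real (m (sroot L i))"] by simp
  qed
  also have "\<dots> = (\<Sum>\<beta>\<in>sroot L ` nodes L. r \<beta>)" by (simp add: sum.reindex[OF inj_sroot])
  also have "\<dots> \<le> (\<Sum>\<beta>\<in>ad_weights. r \<beta>)"
    using roots_ad_weights sroot_roots by (intro sum_mono2 finite_ad_weights) (auto simp: r_def)
  finally show thesis using that 1 by blast
qed

lemma zplus_hdual: "K \<subseteq> nodes L \<Longrightarrow> \<beta> \<in> zplus L K \<Longrightarrow> \<beta> \<in> hdual L"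
  unfolding zplus_def by (auto intro!: hdual_sum hdual_scale sroot_hdual)

lemma zplus_0: "0 \<in> zplus L K"
  unfolding zplus_def by (auto intro!: exI[of _ "\<lambda>_. 0"] simp: fun_eq_iff sum_fun_apply)

end

section \<open>Highest weight modules\<close>

lemma span_words: "module.span tscale (range word) = UNIV"
proof -
  interpret ts: vector_space tscale by (rule vector_space_tscale)
  have "p \<in> ts.span (range word)" for p :: "'g list \<Rightarrow>\<^sub>0 complex"
  proof -
    have "p = (\<Sum>u\<in>Poly_Mapping.keys p. tscale (poly_mapping.lookup p u) (word u))"
    proof (rule poly_mapping_eqI)
      fix k
      show "poly_mapping.lookup p k = poly_mapping.lookup
          (\<Sum>u\<in>Poly_Mapping.keys p. tscale (poly_mapping.lookup p u) (word u)) k"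
        by (simp add: lookup_sum lookup_tscale word_def lookup_single when_def sum.If_cases
            in_keys_iff if_distrib[of "(*) _"] sum.delta' cong: if_cong)
    qed
    also have "\<dots> \<in> ts.span (range word)" by (intro ts.span_sum ts.span_scale ts.span_base) auto
    finally show ?thesis .
  qed
  then show ?thesis by auto
qed

locale highest_weight = semisimple_chevalley L
  for L :: "('g::ab_group_add, 'i, 'b) chev_lie_alg_scheme" +
  fixes lam :: "'g \<Rightarrow> complex" and V :: "('g, 'v::ab_group_add, 'c) lie_rep_scheme" and v :: 'v
  assumes lam_hdual: "lam \<in> hdual L" and highest_weight_module: "highest_weight_module L lam V v"

sublocale highest_weight \<subseteq> rep: lie_rep_on L V
  using lie_algebra highest_weight_module by unfold_locales (auto simp: highest_weight_module_def)

context highest_weight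
begin

lemma verma_map:
  obtains \<phi> where "Vector_Spaces.linear tscale (mscale V) \<phi>" "surj \<phi>"
    "\<And>x u. \<phi> (word (x # u)) = act V x (\<phi> (word u))" "\<And>p. p \<in> verma_kernel L lam \<Longrightarrow> \<phi> p = 0"
    "\<phi> (word []) = v"
  using highest_weight_module unfolding highest_weight_module_def verma_quotient_def by blast

text \<open>The images of words span \<open>V\<close>, and the image of a word arises from
  \<open>v\<close> by letting its letters act one after another.\<close>

lemma highest_weight_induct:
  assumes N: "rep.subspace N" and v: "v \<in> N" and act: "\<And>x u. u \<in> N \<Longrightarrow> act V x u \<in> N"
  shows "u \<in> N"
proof -
  obtain \<phi> where \<phi>: "Vector_Spaces.linear tscale (mscale V) \<phi>" "surj \<phi>"
    "\<And>x u. \<phi> (word (x # u)) = act V x (\<phi> (word u))" "\<phi> (word []) = v"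
    by (rule verma_map) blast
  interpret \<phi>: Vector_Spaces.linear tscale "mscale V" \<phi> by (fact \<phi>(1))
  have "\<phi> (word us) \<in> N" for us by (induction us) (simp_all add: \<phi>(3,4) v act)
  then have "\<phi>.vs1.span (range word) \<subseteq> {p. \<phi> p \<in> N}"
    by (intro \<phi>.vs1.span_minimal \<phi>.subspace_linear_preimage N) auto
  then show ?thesis using \<phi>(2) unfolding span_words by (metis UNIV_I mem_Collect_eq subsetD surjD)
qed

lemma v_nonzero: "v \<noteq> 0"
proof
  assume "v = 0"
  have "u \<in> {0}" for u :: 'v by (rule highest_weight_induct[of "{0}"]) (auto simp: \<open>v = 0\<close>)
  then show False using highest_weight_module by (auto simp: highest_weight_module_def)
qed

lemma v_weight: "v \<in> weight_space L V lam"
  unfolding weight_space_def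
proof safe
  fix h assume h: "h \<in> cartan L"
  obtain \<phi> where \<phi>: "Vector_Spaces.linear tscale (mscale V) \<phi>"
    "\<And>x u. \<phi> (word (x # u)) = act V x (\<phi> (word u))" "\<And>p. p \<in> verma_kernel L lam \<Longrightarrow> \<phi> p = 0"
    "\<phi> (word []) = v"
    by (rule verma_map) blast
  interpret \<phi>: Vector_Spaces.linear tscale "mscale V" \<phi> by (fact \<phi>(1))
  have "word ([] @ [h]) - tscale (lam h) (word []) \<in> verma_kernel L lam"
    unfolding verma_kernel_def using h by (intro \<phi>.vs1.span_base) blast
  from \<phi>(3)[OF this] show "act V h v = mscale V (lam h) v"
    by (simp add: \<phi>.diff \<phi>.scale \<phi>(2,4))
qed

lemma xplus_v: "i \<in> nodes L \<Longrightarrow> act V (xplus L i) v = 0"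
proof -
  assume i: "i \<in> nodes L"
  obtain \<phi> where \<phi>: "Vector_Spaces.linear tscale (mscale V) \<phi>"
    "\<And>x u. \<phi> (word (x # u)) = act V x (\<phi> (word u))" "\<And>p. p \<in> verma_kernel L lam \<Longrightarrow> \<phi> p = 0"
    "\<phi> (word []) = v"
    by (rule verma_map) blast
  interpret \<phi>: Vector_Spaces.linear tscale "mscale V" \<phi> by (fact \<phi>(1))
  have "0 + sroot L i \<in> zplus L (nodes L)" by (rule zplus_add_sroot[OF order_refl zplus_0 i])
  then have "sroot L i \<in> pos_roots L" using sroot_roots[OF i] by (simp add: pos_roots_def)
  then have "xplus L i \<in> nplus L"
    unfolding nplus_def using xplus_root[OF i] by (intro ad.span_base) blast
  then have "word ([] @ [xplus L i]) \<in> verma_kernel L lam"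
    unfolding verma_kernel_def by (intro \<phi>.vs1.span_base) blast
  from \<phi>(3)[OF this] show ?thesis by (simp add: \<phi>(2,4))
qed

text \<open>Monomials in the simple lowering generators applied to \<open>v\<close>, the head of the
  list acting last. Repetitions and all orders are allowed; linear relations among these vectors do
  no harm, since they are used only as a spanning set of weight vectors.\<close>

definition lower :: "'i list \<Rightarrow> 'v" where
  "lower is = foldr (\<lambda>i. act V (xminus L i)) is v"

lemma lower_simps [simp]: "lower [] = v" "lower (i # is) = act V (xminus L i) (lower is)"
  by (simp_all add: lower_def)

primrec depth :: "'i list \<Rightarrow> 'g \<Rightarrow> complex" where
  "depth [] = 0"
| "depth (i # is) = depth is + sroot L i"

lemma depth_zplus: "K \<subseteq> nodes L \<Longrightarrow> set is \<subseteq> K \<Longrightarrow> depth is \<in> zplus L K"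
  by (induction "is") (simp_all add: zplus_0 zplus_add_sroot)

lemma depth_hdual: "set is \<subseteq> nodes L \<Longrightarrow> depth is \<in> hdual L"
  using depth_zplus[of "nodes L"] zplus_hdual by blast

lemma coeff_depth: "set is \<subseteq> nodes L \<Longrightarrow> i \<in> nodes L \<Longrightarrow> coeff (depth is) i = of_nat (count_list is i)"
proof (induction "is")
  case Nil
  then show ?case using coeff_sroot_sum[of i "\<lambda>_. 0"] coeff_scale[OF hdual_0, of 0 i]
    by (simp add: fscale_def zero_fun_def)
next
  case (Cons k "is")
  then have "coeff (depth (k # is)) i = coeff (depth is) i + coeff (sroot L k) i"
    unfolding depth.simps by (intro coeff_add depth_hdual sroot_hdual) auto
  also have "\<dots> = of_nat (count_list (k # is) i)" using Cons by (simp add: coeff_sroot)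
  finally show ?case .
qed

text \<open>The coordinates of the depth count the letters, so the weight of a monomial determines
  which letters occur in it.\<close>

lemma depth_zplus_iff:
  assumes "K \<subseteq> nodes L" "set is \<subseteq> nodes L"
  shows "depth is \<in> zplus L K \<longleftrightarrow> set is \<subseteq> K"
proof
  assume *: "depth is \<in> zplus L K"
  show "set is \<subseteq> K"
  proof
    fix i assume i: "i \<in> set is"
    then have "count_list is i \<noteq> 0" by (simp add: count_list_0_iff)
    then show "i \<in> K" using * i assms coeff_depth[of "is" i] unfolding zplus_iff[OF assms(1)]
      by (metis DiffI of_nat_eq_0_iff subsetD)
  qed
qed (rule depth_zplus[OF assms(1)])

lemma lower_weight: "set is \<subseteq> nodes L \<Longrightarrow> lower is \<in> weight_space L V (lam - depth is)"
proof (induction "is")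
  case Nil
  have "lam - depth [] = lam" by (simp add: fun_eq_iff)
  with v_weight show ?case by simp
next
  case (Cons i "is")
  have "lam - depth (i # is) = lam - depth is + - sroot L i" by simp
  moreover have "act V (xminus L i) (lower is) \<in> weight_space L V (lam - depth is + - sroot L i)"
    by (rule rep.act_root_space[OF xminus_root]) (use Cons in simp, use Cons in \<open>meson list.set_intros(2) subset_code(1)\<close>)
  ultimately show ?case unfolding lower_simps by metis
qed

text \<open>The raising generator commutes with every lowering generator of a different node and so
  reaches \<open>v\<close>, which it kills.\<close>

lemma xplus_lower:
  assumes j: "j \<in> nodes L" and "is": "set is \<subseteq> nodes L" and "j \<notin> set is"
  shows "act V (xplus L j) (lower is) = 0"
  using assms(2,3)
proof (induction "is")
  case Nil
  with j show ?case by (simp add: xplus_v)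
next
  case (Cons i "is")
  have "act V (xplus L j) (lower (i # is))
      = act V (lbracket L (xplus L j) (xminus L i)) (lower is) + act V (xminus L i) (act V (xplus L j) (lower is))"
    by (simp add: rep.act_bracket)
  with Cons bracket_xplus_xminus[OF j, of i] show ?case by simp
qed

text \<open>The span contains \<open>v\<close> and is stable under lowering. It is stable under
  raising too: moving a raising generator to the right costs a coroot, which acts on a monomial by a
  scalar. Stability under the generators gives stability under the whole Lie algebra.\<close>

lemma span_lower: "rep.span (lower ` lists (nodes L)) = UNIV"
proof -
  let ?G = "lower ` lists (nodes L)" and ?N = "rep.span (lower ` lists (nodes L))"
  have extend: "act V x u \<in> ?N" if "\<And>is. set is \<subseteq> nodes L \<Longrightarrow> act V x (lower is) \<in> ?N" "u \<in> ?N" for x u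
  proof -
    interpret l: Vector_Spaces.linear "mscale V" "mscale V" "act V x" by (rule rep.linear_act)
    have "?N \<subseteq> {u. act V x u \<in> ?N}"
      using that(1) by (intro rep.span_minimal l.subspace_linear_preimage) auto
    with that(2) show ?thesis by blast
  qed
  have base: "lower is \<in> ?N" if "set is \<subseteq> nodes L" for "is" using that by (intro rep.span_base) auto
  have minus: "act V (xminus L i) u \<in> ?N" if "i \<in> nodes L" "u \<in> ?N" for i u
    using base[of "i # is" for "is"] that by (intro extend[OF _ that(2)]) simp
  have "act V (xplus L j) (lower is) \<in> ?N" if j: "j \<in> nodes L" and "set is \<subseteq> nodes L" for j "is"
    using that(2)
  proof (induction "is")
    case Nil
    with j show ?case by (simp add: xplus_v rep.span_zero)
  next
    case (Cons i "is")
    have "act V (lbracket L (xplus L j) (xminus L i)) (lower is) \<in> ?N"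
    proof (cases "i = j")
      case True
      have "act V (coroot L j) (lower is) = mscale V ((lam - depth is) (coroot L j)) (lower is)"
        using Cons.prems by (intro rep.weight_spaceD[OF lower_weight coroot_cartan[OF j]]) simp
      with True Cons.prems base show ?thesis by (simp add: coroot_def rep.span_scale)
    next
      case False
      with Cons.prems bracket_xplus_xminus[OF j, of i] show ?thesis by (simp add: rep.span_zero)
    qed
    moreover have "act V (xminus L i) (act V (xplus L j) (lower is)) \<in> ?N"
      using Cons by (intro minus) auto
    ultimately have "act V (lbracket L (xplus L j) (xminus L i)) (lower is)
        + act V (xminus L i) (act V (xplus L j) (lower is)) \<in> ?N"
      by (rule rep.span_add)
    then show ?case by (simp add: rep.act_bracket)
  qed
  then have plus: "act V (xplus L j) u \<in> ?N" if "j \<in> nodes L" "u \<in> ?N" for j u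
    using that by (intro extend[OF _ that(2)]) blast
  have "x \<in> {x. \<forall>u\<in>?N. act V x u \<in> ?N}" for x
    by (rule generated[OF rep.subalgebra_stabilizer[OF rep.subspace_span]]) (use minus plus in blast)+
  then have act: "act V x u \<in> ?N" if "u \<in> ?N" for x u using that by blast
  have "v \<in> ?N" using base[of "[]"] by simp
  then have "u \<in> ?N" for u by (rule highest_weight_induct[OF rep.subspace_span _ act])
  then show ?thesis by blast
qed

section \<open>Weights of the module as weights of nonzero monomials\<close>

lemma wt_hdual: "x \<in> wt L V \<Longrightarrow> x \<in> hdual L"
  by (simp add: wt_def)

lemma wtI: "u \<in> weight_space L V x \<Longrightarrow> u \<noteq> 0 \<Longrightarrow> x \<in> hdual L \<Longrightarrow> x \<in> wt L V"
  by (auto simp: wt_def)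

lemma wt_vector:
  assumes "x \<in> wt L V"
  obtains u where "u \<in> weight_space L V x" "u \<noteq> 0"
  using assms rep.subspace_0[OF rep.subspace_weight_space, of x] unfolding wt_def by blast

lemma wt_lower:
  assumes "x \<in> wt L V"
  obtains "is" where "set is \<subseteq> nodes L" "lower is \<noteq> 0" "x = lam - depth is"
proof -
  let ?A = "{lam - depth is |is. set is \<subseteq> nodes L \<and> lower is \<noteq> 0}"
  obtain u where u: "u \<in> weight_space L V x" "u \<noteq> 0" using assms by (rule wt_vector)
  \<comment> \<open>Zero is adjoined to accommodate vanishing monomials, whose formal weight need
    not be a weight of \<open>V\<close>.\<close>
  have "lower is \<in> insert 0 (\<Union>\<mu>\<in>?A. weight_space L V \<mu>)" if "set is \<subseteq> nodes L" for "is"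
  proof (cases "lower is = 0")
    case False
    with that have "lam - depth is \<in> ?A" by blast
    with lower_weight[OF that] show ?thesis by blast
  qed simp
  then have "lower ` lists (nodes L) \<subseteq> insert 0 (\<Union>\<mu>\<in>?A. weight_space L V \<mu>)"
    unfolding lists_eq_set by blast
  from rep.span_mono[OF this] have "u \<in> rep.span (\<Union>\<mu>\<in>?A. weight_space L V \<mu>)"
    unfolding span_lower rep.span_insert_0 by blast
  moreover have "?A \<subseteq> hdual L" using depth_hdual lam_hdual hdual_diff by blast
  ultimately have "x \<in> ?A" using rep.weight_of_span u wt_hdual[OF assms] by blast
  then show thesis using that by blast
qed

lemma lam_wt: "lam \<in> wt L V"
  by (rule wtI[OF v_weight v_nonzero lam_hdual])

lemma wt_zplus: "x \<in> wt L V \<Longrightarrow> lam - x \<in> zplus L (nodes L)"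
  by (erule wt_lower) (simp add: depth_zplus)

lemma wt_J_iff: "x \<in> wt_J L lam V K \<longleftrightarrow> x \<in> wt L V \<and> lam - x \<in> zplus L K"
proof -
  have "x \<in> {lam - \<beta> |\<beta>. \<beta> \<in> zplus L K} \<longleftrightarrow> lam - x \<in> zplus L K"
    by (auto intro!: exI[of _ "lam - x"])
  then show ?thesis unfolding wt_J_def by blast
qed

lemma lam_wt_J: "lam \<in> wt_J L lam V K"
  by (simp add: wt_J_iff lam_wt zplus_0)

section \<open>Integrability\<close>

lemma J_mod_nodes: "J_mod L lam V v \<subseteq> nodes L"
  by (auto simp: J_mod_def J_lam_def)

lemma lam_coroot_Nats: "j \<in> J_mod L lam V v \<Longrightarrow> lam (coroot L j) \<in> \<nat>"
  by (auto simp: J_mod_def J_lam_def)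

lemma funpow_act_zero: "(act V x ^^ n) 0 = 0"
  by (induction n) auto

lemma funpow_act_add: "(act V x ^^ n) (u + w) = (act V x ^^ n) u + (act V x ^^ n) w"
  by (induction n) (auto simp: rep.act_add)

lemma funpow_act_scale: "(act V x ^^ n) (mscale V c u) = mscale V c ((act V x ^^ n) u)"
  by (induction n) (auto simp: rep.act_scale)

lemma funpow_act_mono: "(act V x ^^ p) u = 0 \<Longrightarrow> p \<le> q \<Longrightarrow> (act V x ^^ q) u = 0"
  by (metis funpow_act_zero funpow_add le_add_diff_inverse2 o_apply)

text \<open>
  \<open>f (x u) = [f, x] u + x (f u)\<close>: each application of \<open>f\<close> raises the order of \<open>f\<close> at \<open>x\<close> or at \<open>u\<close> by
  one.
\<close>

lemma funpow_act_act:
  "(lbracket L f ^^ p) x = 0 \<Longrightarrow> (act V f ^^ q) u = 0 \<Longrightarrow> (act V f ^^ (p + q)) (act V x u) = 0"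
proof (induction "p + q" arbitrary: p q x u)
  case 0
  then show ?case by simp
next
  case (Suc n)
  show ?case
  proof (cases "p = 0 \<or> q = 0")
    case True
    with Suc.prems show ?thesis by (auto simp: funpow_act_zero)
  next
    case False
    then obtain p' q' where pq: "p = Suc p'" "q = Suc q'" by (metis not0_implies_Suc)
    have "(act V f ^^ (p + q)) (act V x u) = (act V f ^^ n) (act V f (act V x u))"
      using Suc.hyps(2) by (metis comp_apply funpow_Suc_right)
    also have "act V f (act V x u) = act V (lbracket L f x) u + act V x (act V f u)"
      by (simp add: rep.act_bracket)
    also have "(act V f ^^ n) \<dots> = 0"
      unfolding funpow_act_add
      using Suc.hyps(1)[of p' q "lbracket L f x" u] Suc.hyps(1)[of p q' x "act V f u"] Suc.hyps(2) Suc.prems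
      by (simp add: pq funpow_Suc_right del: funpow.simps)
    finally show ?thesis .
  qed
qed

text \<open>The vectors killed by some power of the lowering generator form a submodule, because its
  adjoint action is locally nilpotent. The definition of \<open>J_mod\<close> puts \<open>v\<close>
  into it.\<close>

lemma xminus_nilpotent:
  assumes j: "j \<in> J_mod L lam V v"
  shows "\<exists>p. (act V (xminus L j) ^^ p) u = 0"
proof -
  let ?N = "{u. \<exists>p. (act V (xminus L j) ^^ p) u = 0}"
  have jn: "j \<in> nodes L" using j J_mod_nodes by blast
  have "rep.subspace ?N"
  proof (rule rep.subspaceI)
    show "0 \<in> ?N" by (auto intro: exI[of _ 0])
    fix y z c assume "y \<in> ?N"
    then obtain p where p: "(act V (xminus L j) ^^ p) y = 0" by blast
    then show "mscale V c y \<in> ?N" by (auto simp: funpow_act_scale intro: exI[of _ p])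
    assume "z \<in> ?N"
    then obtain q where q: "(act V (xminus L j) ^^ q) z = 0" by blast
    have "(act V (xminus L j) ^^ max p q) (y + z) = 0"
      using funpow_act_mono[OF p] funpow_act_mono[OF q] by (simp add: funpow_act_add)
    then show "y + z \<in> ?N" by blast
  qed
  moreover have "v \<in> ?N"
  proof -
    obtain n where "lam (coroot L j) = of_nat n" using j unfolding J_mod_def J_lam_def by (auto elim: Nats_cases)
    then have "(act V (xminus L j) ^^ (n + 1)) v = 0" using j unfolding J_mod_def by blast
    then show ?thesis by blast
  qed
  moreover have "act V x w \<in> ?N" if "w \<in> ?N" for x w
    using that xminus_locally_nilpotent[OF jn, of x] funpow_act_act by blast
  ultimately show ?thesis using highest_weight_induct[of ?N u] by blast
qed

text \<open>Each application of the raising generator lowers the j-th coefficient of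
  \<open>lam - x\<close> by one, and for a weight this coefficient is a natural number.\<close>

lemma xplus_nilpotent:
  assumes j: "j \<in> nodes L" and x: "x \<in> hdual L" and u: "u \<in> weight_space L V x"
  shows "\<exists>p. (act V (xplus L j) ^^ p) u = 0"
proof (rule ccontr)
  assume *: "\<not> ?thesis"
  let ?x = "\<lambda>p. x + fscale (of_nat p) (sroot L j)"
  have "?x p \<in> wt L V" for p
    using rep.act_root_space_funpow[OF xplus_root[OF j] u] * x j
    by (intro wtI[of "(act V (xplus L j) ^^ p) u"]) (auto intro!: hdual_add hdual_scale sroot_hdual)
  then have "lam - ?x p \<in> zplus L (nodes L)" for p by (rule wt_zplus)
  then have "coeff (lam - ?x p) j \<in> \<nat>" for p unfolding zplus_iff[OF order_refl] using j by blast
  moreover have "coeff (lam - ?x p) j = coeff (lam - x) j - of_nat p" for p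
    using j x lam_hdual
    by (simp only: coeff_diff coeff_add coeff_scale coeff_sroot hdual_add hdual_scale sroot_hdual) simp
  ultimately have nat: "coeff (lam - x) j - of_nat p \<in> \<nat>" for p by metis
  from nat[of 0] obtain n where n: "coeff (lam - x) j = of_nat n" by (auto elim: Nats_cases)
  from nat[of "Suc n"] obtain k where "(of_nat n :: complex) - of_nat (Suc n) = of_nat k"
    unfolding n by (rule Nats_cases)
  then have "(of_nat n :: complex) = of_nat (k + Suc n)" by (simp only: diff_eq_eq of_nat_add)
  then show False by (simp only: of_nat_eq_iff)
qed

lemma coroot_act:
  "j \<in> nodes L \<Longrightarrow> act V (xplus L j) (act V (xminus L j) u) - act V (xminus L j) (act V (xplus L j) u)
    = act V (coroot L j) u"
  by (simp add: coroot_def rep.act_bracket)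

lemma highest_vector_string:
  assumes j: "j \<in> J_mod L lam V v" and u: "u \<in> weight_space L V x" "u \<noteq> 0"
    and E: "act V (xplus L j) u = 0"
  obtains n where "x (coroot L j) = of_nat n" "\<And>k. k \<le> n \<Longrightarrow> (act V (xminus L j) ^^ k) u \<noteq> 0"
    "(act V (xminus L j) ^^ Suc n) u = 0"
proof -
  have jn: "j \<in> nodes L" using j J_mod_nodes by blast
  have H: "act V (coroot L j) ((act V (xminus L j) ^^ k) u)
      = mscale V (x (coroot L j) - 2 * of_nat k) ((act V (xminus L j) ^^ k) u)" for k
    using rep.weight_spaceD[OF rep.act_root_space_funpow[OF xminus_root[OF jn] u(1)] coroot_cartan[OF jn]]
    by (simp add: sroot_coroot[OF jn] mult.commute)
  obtain p where "(act V (xminus L j) ^^ p) u = 0" using xminus_nilpotent[OF j] by blast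
  from sl2_highest_weight_nat[OF rep.linear_act rep.linear_act coroot_act[OF jn] H E u(2) this]
  show thesis using that by blast
qed

text \<open>The string argument with the operators exchanged. It rests on nilpotency of raising,
  which holds at every node, so membership in \<open>J_mod\<close> is not asked for.\<close>

lemma lowest_vector_string:
  assumes j: "j \<in> nodes L" and x: "x \<in> hdual L" and u: "u \<in> weight_space L V x" "u \<noteq> 0"
    and F: "act V (xminus L j) u = 0"
  obtains n where "x (coroot L j) = - of_nat n" "\<And>k. k \<le> n \<Longrightarrow> (act V (xplus L j) ^^ k) u \<noteq> 0"
proof -
  have comm: "act V (xminus L j) (act V (xplus L j) w) - act V (xplus L j) (act V (xminus L j) w)
      = - act V (coroot L j) w" for w
    using coroot_act[OF j, of w] by (simp add: algebra_simps)
  have H: "- act V (coroot L j) ((act V (xplus L j) ^^ k) u)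
      = mscale V (- x (coroot L j) - 2 * of_nat k) ((act V (xplus L j) ^^ k) u)" for k
    using rep.weight_spaceD[OF rep.act_root_space_funpow[OF xplus_root[OF j] u(1)] coroot_cartan[OF j]]
    by (simp add: sroot_coroot[OF j] mult.commute flip: rep.scale_minus_left)
  obtain p where "(act V (xplus L j) ^^ p) u = 0" using xplus_nilpotent[OF j x u(1)] by blast
  from sl2_highest_weight_nat[OF rep.linear_act rep.linear_act comm H F u(2) this]
  obtain n where "- x (coroot L j) = of_nat n" "\<forall>k\<le>n. (act V (xplus L j) ^^ k) u \<noteq> 0" by blast
  with that show thesis by (metis minus_minus)
qed

lemma last_nonzero_power:
  assumes "(act V y ^^ p) u = 0" "u \<noteq> 0"
  obtains k where "(act V y ^^ k) u \<noteq> 0" "act V y ((act V y ^^ k) u) = 0"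
proof -
  define n where "n = (LEAST n. (act V y ^^ n) u = 0)"
  have n0: "(act V y ^^ n) u = 0" unfolding n_def by (rule LeastI[of _ p]) (rule assms(1))
  then obtain k where k: "n = Suc k" using assms(2) by (cases n) auto
  then have "(act V y ^^ k) u \<noteq> 0" using not_less_Least[of k "\<lambda>n. (act V y ^^ n) u = 0"] n_def by simp
  with that n0 k show thesis by simp
qed

text \<open>
  Going up from \<open>x\<close> to the top of its string and down again reaches the reflected weight if
  \<open>x(h\<^sub>j) \<ge> 0\<close>; going down first and up again does so if \<open>x(h\<^sub>j) \<le> 0\<close>.
\<close>

lemma wt_reflection:
  assumes j: "j \<in> J_mod L lam V v" and x: "x \<in> wt L V"
  shows "x (coroot L j) \<in> \<int>" and "x - fscale (x (coroot L j)) (sroot L j) \<in> wt L V"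
proof -
  let ?h = "coroot L j" and ?\<alpha> = "sroot L j"
  let ?E = "act V (xplus L j)" and ?F = "act V (xminus L j)"
  have jn: "j \<in> nodes L" using j J_mod_nodes by blast
  have xh: "x \<in> hdual L" using x by (rule wt_hdual)
  obtain u where u: "u \<in> weight_space L V x" "u \<noteq> 0" using x by (rule wt_vector)
  obtain p where "(?E ^^ p) u = 0" using xplus_nilpotent[OF jn xh u(1)] by blast
  then obtain k where k: "(?E ^^ k) u \<noteq> 0" "?E ((?E ^^ k) u) = 0" using u(2) by (rule last_nonzero_power)
  have ku: "(?E ^^ k) u \<in> weight_space L V (x + fscale (of_nat k) ?\<alpha>)"
    by (rule rep.act_root_space_funpow[OF xplus_root[OF jn] u(1)])
  obtain n where n: "(x + fscale (of_nat k) ?\<alpha>) ?h = of_nat n"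
    "\<And>i. i \<le> n \<Longrightarrow> (?F ^^ i) ((?E ^^ k) u) \<noteq> 0"
    using highest_vector_string[OF j ku k] by blast
  have xn: "x ?h = of_nat n - 2 * of_nat k"
    using n(1) by (simp add: sroot_coroot[OF jn] algebra_simps eq_diff_eq)
  show "x ?h \<in> \<int>" unfolding xn by simp
  obtain p where "(?F ^^ p) u = 0" using xminus_nilpotent[OF j] by blast
  then obtain l where l: "(?F ^^ l) u \<noteq> 0" "?F ((?F ^^ l) u) = 0" using u(2) by (rule last_nonzero_power)
  have lu: "(?F ^^ l) u \<in> weight_space L V (x + fscale (of_nat l) (- ?\<alpha>))"
    by (rule rep.act_root_space_funpow[OF xminus_root[OF jn] u(1)])
  have lh: "x + fscale (of_nat l) (- ?\<alpha>) \<in> hdual L"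
    using xh jn by (intro hdual_add hdual_scale hdual_neg sroot_hdual)
  obtain m where m: "(x + fscale (of_nat l) (- ?\<alpha>)) ?h = - of_nat m"
    "\<And>i. i \<le> m \<Longrightarrow> (?E ^^ i) ((?F ^^ l) u) \<noteq> 0"
    using lowest_vector_string[OF jn lh lu l] by blast
  have xm: "x ?h = 2 * of_nat l - of_nat m"
    using m(1) by (simp add: sroot_coroot[OF jn] algebra_simps eq_diff_eq)
  have sh: "x - fscale (x ?h) ?\<alpha> \<in> hdual L"
    using xh jn by (intro hdual_diff hdual_scale sroot_hdual)
  \<comment> \<open>Both strings compute the value at the coroot: n - 2k = 2l - m. If k exceeds n,
    then m is large enough for the second route, which needs l at most m.\<close>
  have "(of_nat (n + m) :: complex) = of_nat (2 * l + 2 * k)"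
    using xn xm by (simp add: algebra_simps)
  then have nm: "n + m = 2 * l + 2 * k" by (simp only: of_nat_eq_iff)
  show "x - fscale (x ?h) ?\<alpha> \<in> wt L V"
  proof (cases "k \<le> n")
    case True
    have "x + fscale (of_nat k) ?\<alpha> + fscale (of_nat (n - k)) (- ?\<alpha>) = x - fscale (x ?h) ?\<alpha>"
      using True unfolding xn by (simp add: fun_eq_iff of_nat_diff algebra_simps)
    from rep.act_root_space_funpow[OF xminus_root[OF jn] ku, of "n - k", unfolded this] show ?thesis
      by (rule wtI) (use n(2) sh in auto)
  next
    case False
    then have lm: "l \<le> m" using nm by simp
    have "x + fscale (of_nat l) (- ?\<alpha>) + fscale (of_nat (m - l)) ?\<alpha> = x - fscale (x ?h) ?\<alpha>"
      using lm unfolding xm by (simp add: fun_eq_iff of_nat_diff algebra_simps)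
    from rep.act_root_space_funpow[OF xplus_root[OF jn] lu, of "m - l", unfolded this] show ?thesis
      by (rule wtI) (use m(2) sh in auto)
  qed
qed

section \<open>Weights in a parabolic direction\<close>

lemma wt_J_mono:
  assumes "J \<subseteq> K" "K \<subseteq> nodes L"
  shows "wt_J L lam V J \<subseteq> wt_J L lam V K"
  using zplus_mono[OF assms] by (auto simp: wt_J_def)

lemma wt_J_wt: "x \<in> wt_J L lam V K \<Longrightarrow> x \<in> wt L V"
  by (simp add: wt_J_iff)

lemma wt_J_hdual: "x \<in> wt_J L lam V K \<Longrightarrow> x \<in> hdual L"
  by (simp add: wt_J_iff wt_hdual)

text \<open>The reflected weight is a weight, so its difference from \<open>lam\<close> has natural
  coefficients. Only the coefficient at \<open>j\<close> has changed, hence those outside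
  \<open>J\<close> stay 0.\<close>

lemma wt_J_reflection:
  assumes J: "J \<subseteq> J_mod L lam V v" and j: "j \<in> J" and x: "x \<in> wt_J L lam V J"
  shows "x - fscale (x (coroot L j)) (sroot L j) \<in> wt_J L lam V J"
proof -
  let ?y = "x - fscale (x (coroot L j)) (sroot L j)"
  have Jn: "J \<subseteq> nodes L" using J J_mod_nodes by blast
  have y: "?y \<in> wt L V" using wt_reflection(2) J j x wt_J_wt by blast
  have "coeff (lam - ?y) i = 0" if i: "i \<in> nodes L - J" for i
  proof -
    have "lam - ?y = (lam - x) + fscale (x (coroot L j)) (sroot L j)" by simp
    moreover have "coeff ((lam - x) + fscale (x (coroot L j)) (sroot L j)) i
        = coeff (lam - x) i + x (coroot L j) * coeff (sroot L j) i"
      using Jn j lam_hdual wt_J_hdual[OF x]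
      by (simp only: coeff_add coeff_scale hdual_diff hdual_scale sroot_hdual subsetD)
    moreover have "coeff (lam - x) i = 0" using x i unfolding wt_J_iff zplus_iff[OF Jn] by blast
    moreover have "coeff (sroot L j) i = 0" using i j Jn by (subst coeff_sroot) auto
    ultimately have "coeff (lam - ?y) i = 0 + x (coroot L j) * 0" by metis
    then show ?thesis by simp
  qed
  then have "lam - ?y \<in> zplus L J"
    using wt_zplus[OF y] unfolding zplus_iff[OF Jn] zplus_iff[OF order_refl] by blast
  with y show ?thesis by (simp add: wt_J_iff)
qed

lemma sum_wt_J_coroot:
  assumes J: "J \<subseteq> J_mod L lam V v" and j: "j \<in> J"
  shows "(\<Sum>x\<in>wt_J L lam V J. x (coroot L j)) = 0"
proof -
  let ?s = "\<lambda>x. x - fscale (x (coroot L j)) (sroot L j)"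
  have jn: "j \<in> nodes L" using J j J_mod_nodes by blast
  have s: "?s x (coroot L j) = - x (coroot L j)" for x by (simp add: sroot_coroot[OF jn])
  have ss: "?s (?s x) = x" for x unfolding s by (simp add: fun_eq_iff)
  have "(\<Sum>x\<in>wt_J L lam V J. x (coroot L j)) = (\<Sum>x\<in>wt_J L lam V J. - x (coroot L j))"
    by (rule sum.reindex_bij_witness[of _ ?s ?s]) (use wt_J_reflection[OF J j] ss s in auto)
  then show ?thesis by (simp add: sum_negf)
qed

text \<open>The highest weight is a natural number at this coroot, and subtracting simple roots from
  \<open>J\<close> can only raise the value, since off-diagonal Cartan entries are
  nonpositive.\<close>

lemma wt_J_coroot_Nats:
  assumes J: "J \<subseteq> J_mod L lam V v" and j: "j \<in> J_mod L lam V v - J" and x: "x \<in> wt_J L lam V J"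
  shows "x (coroot L j) \<in> \<nat>"
proof -
  have Jn: "J \<subseteq> nodes L" and jn: "j \<in> nodes L" using J j J_mod_nodes by auto
  have \<gamma>: "lam - x \<in> zplus L J" using x by (simp add: wt_J_iff)
  have "(lam - x) (coroot L j) = (\<Sum>i\<in>nodes L. coeff (lam - x) i * sroot L i (coroot L j))"
    using \<gamma> zplus_hdual[OF Jn] hdual_apply_coeff by blast
  then have "x (coroot L j)
      = lam (coroot L j) + (\<Sum>i\<in>nodes L. coeff (lam - x) i * - sroot L i (coroot L j))"
    by (simp add: sum_negf algebra_simps)
  also have "\<dots> \<in> \<nat>"
  proof (intro Nats_add Nats_sum)
    show "lam (coroot L j) \<in> \<nat>" using j by (intro lam_coroot_Nats) simp
    fix i assume i: "i \<in> nodes L"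
    show "coeff (lam - x) i * - sroot L i (coroot L j) \<in> \<nat>"
    proof (cases "i = j")
      case True
      then have "coeff (lam - x) i = 0" using \<gamma> i j unfolding zplus_iff[OF Jn] by blast
      then show ?thesis by simp
    next
      case False
      then show ?thesis
        using cartan_matrix_nonpos[OF i jn False] \<gamma> i unfolding zplus_iff[OF Jn]
        by (auto intro!: Nats_mult)
    qed
  qed
  finally show ?thesis .
qed

text \<open>
  Every \<open>\<mu> \<in> wt\<^sub>J V\<close> has square length at most \<open>(\<lambda>, \<lambda>)\<close>, stated here in terms of \<open>\<gamma> = \<lambda> - \<mu>\<close> since
  \<open>(\<lambda>, \<lambda>)\<close> need not be real. A reflection raising \<open>\<mu>\<close> preserves the length, which reduces the
  claim to \<open>J\<close>-dominant \<open>\<mu>\<close>.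
\<close>

lemma wt_J_norm_bound:
  assumes J: "J \<subseteq> J_mod L lam V v" and x: "x \<in> wt_J L lam V J"
  shows "\<exists>r\<le>0. hform L (lam - x) (lam - x) - 2 * hform L lam (lam - x) = complex_of_real r"
proof -
  have Jn: "J \<subseteq> nodes L" using J J_mod_nodes by blast
  have "\<exists>d. (\<Sum>i\<in>nodes L. coeff (lam - x) i) = of_nat d"
  proof -
    have "(\<Sum>i\<in>nodes L. coeff (lam - x) i) \<in> \<nat>"
      using x unfolding wt_J_iff zplus_iff[OF Jn] by (intro Nats_sum) blast
    then show ?thesis by (auto elim: Nats_cases)
  qed
  then obtain d where "(\<Sum>i\<in>nodes L. coeff (lam - x) i) = of_nat d" by blast
  \<comment> \<open>Induction on the height of \<open>lam - x\<close>: a reflection with negative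
    \<open>x (coroot L j)\<close> adds this value to the height.\<close>
  then show ?thesis using x
  proof (induction d arbitrary: x rule: less_induct)
    case (less d)
    have d: "(\<Sum>i\<in>nodes L. coeff (lam - x) i) = of_nat d" by (rule less.prems(1))
    have x: "x \<in> wt_J L lam V J" by (rule less.prems(2))
    have xh: "x \<in> hdual L" by (rule wt_J_hdual[OF x])
    have \<gamma>h: "lam - x \<in> hdual L" by (rule hdual_diff[OF lam_hdual xh])
    have int: "x (coroot L j) \<in> \<int>" if "j \<in> J" for j
      using wt_reflection(1) J that wt_J_wt[OF x] by blast
    show ?case
    proof (cases "\<forall>j\<in>J. x (coroot L j) \<in> \<nat>")
      case True
      \<comment> \<open>In the dominant case the quantity is -(\<lambda> + x, \<gamma>), a sum of
        nonpositive terms supported on \<open>J\<close>.\<close>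
      have "hform L (lam - x) (lam - x) - 2 * hform L lam (lam - x)
          = - (hform L lam (lam - x) + hform L x (lam - x))"
        by (simp add: hform_diff_left[OF lam_hdual xh \<gamma>h])
      also have "\<dots> = - (\<Sum>i\<in>nodes L. coeff (lam - x) i * of_real (coroot_scale i)
          * (lam (coroot L i) + x (coroot L i)))"
        by (simp add: hform_coeff[OF lam_hdual \<gamma>h] hform_coeff[OF xh \<gamma>h] sum.distrib[symmetric]
            algebra_simps)
      finally have eq: "hform L (lam - x) (lam - x) - 2 * hform L lam (lam - x)
        = - (\<Sum>i\<in>nodes L. coeff (lam - x) i * of_real (coroot_scale i) * (lam (coroot L i) + x (coroot L i)))" .
      have "coeff (lam - x) i * of_real (coroot_scale i) * (lam (coroot L i) + x (coroot L i)) \<in> \<real>\<^sub>\<ge>\<^sub>0"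
        if i: "i \<in> nodes L" for i
      proof (cases "i \<in> J")
        case True
        then have "lam (coroot L i) + x (coroot L i) \<in> \<nat>"
          using \<open>\<forall>j\<in>J. _\<close> J lam_coroot_Nats by (intro Nats_add) auto
        moreover have "coeff (lam - x) i \<in> \<nat>" using x i unfolding wt_J_iff zplus_iff[OF Jn] by blast
        ultimately show ?thesis using coroot_scale_pos[OF i]
          by (auto elim!: Nats_cases intro!: nonneg_Reals_mult_I)
      next
        case False
        then have "coeff (lam - x) i = 0" using x i unfolding wt_J_iff zplus_iff[OF Jn] by blast
        then show ?thesis by simp
      qed
      then have "(\<Sum>i\<in>nodes L. coeff (lam - x) i * of_real (coroot_scale i)
          * (lam (coroot L i) + x (coroot L i))) \<in> \<real>\<^sub>\<ge>\<^sub>0"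
        by (intro nonneg_Reals_sum)
      then obtain r where "r \<ge> 0" "(\<Sum>i\<in>nodes L. coeff (lam - x) i * of_real (coroot_scale i)
          * (lam (coroot L i) + x (coroot L i))) = complex_of_real r"
        by (rule nonneg_Reals_cases)
      then show ?thesis unfolding eq by (intro exI[of _ "- r"]) simp
    next
      case False
      then obtain j where j: "j \<in> J" "x (coroot L j) \<notin> \<nat>" by blast
      have jn: "j \<in> nodes L" using j Jn by blast
      obtain m where m: "x (coroot L j) = of_int m" using int[OF j(1)] by (rule Ints_cases)
      have "m < 0"
      proof (rule ccontr)
        assume "\<not> m < 0"
        then have "(of_int m :: complex) = of_nat (nat m)" by simp
        with j(2) m show False by (metis of_nat_in_Nats)
      qed
      let ?y = "x - fscale (x (coroot L j)) (sroot L j)"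
      let ?\<delta> = "fscale (x (coroot L j)) (sroot L j)"
      have y: "?y \<in> wt_J L lam V J" by (rule wt_J_reflection[OF J j(1) x])
      have \<delta>h: "?\<delta> \<in> hdual L" using jn by (intro hdual_scale sroot_hdual)
      have ly: "lam - ?y = (lam - x) + ?\<delta>" by simp
      have "(\<Sum>i\<in>nodes L. coeff (lam - ?y) i) \<in> \<nat>"
        using y unfolding wt_J_iff zplus_iff[OF Jn] by (intro Nats_sum) blast
      then obtain d' where d': "(\<Sum>i\<in>nodes L. coeff (lam - ?y) i) = of_nat d'" by (rule Nats_cases)
      have "(\<Sum>i\<in>nodes L. coeff (lam - ?y) i)
          = (\<Sum>i\<in>nodes L. coeff (lam - x) i + (if i = j then x (coroot L j) else 0))"
        unfolding ly by (rule sum.cong)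
          (simp_all only: coeff_add[OF \<gamma>h \<delta>h] coeff_scale[OF sroot_hdual[OF jn]] coeff_sroot[OF _ jn], simp)
      also have "\<dots> = of_nat d + of_int m"
        unfolding sum.distrib using jn d by (simp add: m)
      finally have "(of_int (int d') :: complex) = of_int (int d + m)" unfolding d' by simp
      then have "int d' = int d + m" by (simp only: of_int_eq_iff)
      then have "d' < d" using \<open>m < 0\<close> by simp
      from less.IH[OF this d' y] obtain r where r: "r \<le> 0"
        "hform L (lam - ?y) (lam - ?y) - 2 * hform L lam (lam - ?y) = complex_of_real r" by blast
      have "hform L \<nu> ?\<delta> = x (coroot L j) * (of_real (coroot_scale j) * \<nu> (coroot L j))"
        if "\<nu> \<in> hdual L" for \<nu>
        using that \<delta>h hform_sym[OF that \<delta>h] hform_sym[OF that sroot_hdual[OF jn]]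
        by (simp only: hform_scale_left sroot_hdual jn flip: hform_sroot[OF that jn])
      note h\<delta> = this
      have sum: "hform L \<nu> (lam - ?y) = hform L \<nu> (lam - x) + hform L \<nu> ?\<delta>" if "\<nu> \<in> hdual L" for \<nu>
        unfolding ly using that \<gamma>h \<delta>h
        by (metis hform_add_left hform_sym hdual_add)
      have "hform L (lam - ?y) (lam - ?y) - 2 * hform L lam (lam - ?y)
          = hform L (lam - x) (lam - x) - 2 * hform L lam (lam - x)
            + 2 * hform L (lam - x) ?\<delta> + hform L ?\<delta> ?\<delta> - 2 * hform L lam ?\<delta>"
        using sum[OF lam_hdual] sum[OF hdual_add[OF \<gamma>h \<delta>h], folded ly] sum[OF \<gamma>h] sum[OF \<delta>h]
          hform_add_left[OF \<gamma>h \<delta>h \<gamma>h, folded ly] hform_add_left[OF \<gamma>h \<delta>h \<delta>h, folded ly] hform_sym[OF \<gamma>h \<delta>h]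
        by (simp only:) (simp add: algebra_simps)
      \<comment> \<open>The extra terms amount to (\<delta>, \<delta>) - 2 (x, \<delta>). Since
        \<delta> takes twice the value of x at the coroot, they cancel: the reflection preserves
        length.\<close>
      also have "\<dots> = hform L (lam - x) (lam - x) - 2 * hform L lam (lam - x)"
        unfolding h\<delta>[OF \<gamma>h] h\<delta>[OF \<delta>h] h\<delta>[OF lam_hdual] by (simp add: sroot_coroot[OF jn] algebra_simps)
      finally show ?thesis using r by metis
    qed
  qed
qed

text \<open>A weight is determined by the values of \<gamma> = \<lambda> - x at the coroots. These
  are integers, and the length bound leaves finitely many choices for each.\<close>

lemma finite_wt_J:
  assumes J: "J \<subseteq> J_mod L lam V v"
  shows "finite (wt_J L lam V J)"
proof -
  have Jn: "J \<subseteq> nodes L" using J J_mod_nodes by blast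
  \<comment> \<open>With y the scaled coroot values of \<gamma>, the real part of (\<lambda>,
    \<gamma>) is the dot product of b and y. Completing the square in |y|^2 \<le> 2 b.y puts y
    within distance sqrt C of b; \<open>N i\<close> is the resulting bound on the unscaled
    integer.\<close>
  define b where "b i = Re (coeff lam i)" for i
  define C where "C = (\<Sum>i\<in>nodes L. (b i)\<^sup>2)"
  define N where "N i = \<lceil>(sqrt C + \<bar>b i\<bar>) / coroot_scale i\<rceil>" for i
  let ?f = "\<lambda>x. \<lambda>i\<in>nodes L. (lam - x) (coroot L i)"
  have bound: "?f x \<in> (\<Pi>\<^sub>E i\<in>nodes L. of_int ` {- N i..N i})" if x: "x \<in> wt_J L lam V J" for x
  proof -
    let ?\<gamma> = "lam - x"
    have \<gamma>: "?\<gamma> \<in> zplus L J" using x by (simp add: wt_J_iff)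
    have \<gamma>h: "?\<gamma> \<in> hdual L" by (rule hdual_diff[OF lam_hdual wt_J_hdual[OF x]])
    have int: "?\<gamma> (coroot L i) \<in> \<int>" if i: "i \<in> nodes L" for i
      unfolding hdual_apply_coeff[OF \<gamma>h, of "coroot L i"]
      using \<gamma> cartan_matrix_Ints[OF _ i] Nats_subset_Ints unfolding zplus_iff[OF Jn]
      by (intro Ints_sum Ints_mult) auto
    define y where "y i = coroot_scale i * Re (?\<gamma> (coroot L i))" for i
    obtain R where R: "hform L ?\<gamma> ?\<gamma> = complex_of_real R" "(\<Sum>i\<in>nodes L. (y i)\<^sup>2) \<le> R"
    proof (rule hform_self_lower_bound[OF \<gamma>h])
      show "?\<gamma> (coroot L i) \<in> \<real>" if "i \<in> nodes L" for i
        using int[OF that] by (auto elim!: Ints_cases)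
    qed (unfold y_def)
    obtain r where r: "r \<le> 0" "hform L ?\<gamma> ?\<gamma> - 2 * hform L lam ?\<gamma> = complex_of_real r"
      using wt_J_norm_bound[OF J x] by blast
    have "Re (hform L lam ?\<gamma>) = (\<Sum>i\<in>nodes L. b i * y i)"
    proof -
      have "hform L lam ?\<gamma> = (\<Sum>i\<in>nodes L. coeff lam i * of_real (coroot_scale i) * ?\<gamma> (coroot L i))"
        unfolding hform_sym[OF lam_hdual \<gamma>h] by (rule hform_coeff[OF \<gamma>h lam_hdual])
      then have "Re (hform L lam ?\<gamma>)
          = (\<Sum>i\<in>nodes L. Re (coeff lam i * of_real (coroot_scale i) * ?\<gamma> (coroot L i)))"
        by (simp only: Re_sum)
      also have "\<dots> = (\<Sum>i\<in>nodes L. b i * y i)"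
      proof (rule sum.cong)
        fix i assume "i \<in> nodes L"
        then obtain z where "?\<gamma> (coroot L i) = of_int z" using int by (blast elim: Ints_cases)
        then show "Re (coeff lam i * of_real (coroot_scale i) * ?\<gamma> (coroot L i)) = b i * y i"
          unfolding b_def y_def by (simp only:) simp
      qed simp
      finally show ?thesis .
    qed
    then have "R \<le> 2 * (\<Sum>i\<in>nodes L. b i * y i)"
      using arg_cong[OF r(2), of Re] r(1) R(1) by simp
    then have "(\<Sum>i\<in>nodes L. (y i)\<^sup>2) - 2 * (\<Sum>i\<in>nodes L. b i * y i) + C \<le> C" using R(2) by simp
    moreover have "(\<Sum>i\<in>nodes L. (y i)\<^sup>2) - 2 * (\<Sum>i\<in>nodes L. b i * y i) + C
        = (\<Sum>i\<in>nodes L. (y i - b i)\<^sup>2)"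
      unfolding C_def sum_distrib_left sum_subtractf[symmetric] sum.distrib[symmetric]
      by (rule sum.cong) (simp_all add: power2_diff algebra_simps)
    ultimately have le: "(\<Sum>i\<in>nodes L. (y i - b i)\<^sup>2) \<le> C" by simp
    have "?\<gamma> (coroot L i) \<in> of_int ` {- N i..N i}" if i: "i \<in> nodes L" for i
    proof -
      obtain z where z: "?\<gamma> (coroot L i) = of_int z" using int[OF i] by (rule Ints_cases)
      have "(y i - b i)\<^sup>2 \<le> C"
        using le member_le_sum[OF i, of "\<lambda>i. (y i - b i)\<^sup>2"] by simp
      then have "\<bar>y i - b i\<bar> \<le> sqrt C" using real_le_rsqrt[of "\<bar>y i - b i\<bar>" C] by simp
      then have "\<bar>y i\<bar> \<le> sqrt C + \<bar>b i\<bar>" by linarith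
      moreover have "\<bar>y i\<bar> = coroot_scale i * \<bar>of_int z\<bar>"
        unfolding y_def z using coroot_scale_pos[OF i] by (simp add: abs_mult)
      ultimately have "\<bar>of_int z\<bar> \<le> (sqrt C + \<bar>b i\<bar>) / coroot_scale i"
        using coroot_scale_pos[OF i] by (simp add: pos_le_divide_eq mult.commute)
      then have "\<bar>z\<bar> \<le> N i" unfolding N_def by linarith
      then show ?thesis unfolding z by (intro imageI) auto
    qed
    then show ?thesis by auto
  qed
  have "inj_on ?f (wt_J L lam V J)"
  proof (rule inj_onI)
    fix x y assume *: "x \<in> wt_J L lam V J" "y \<in> wt_J L lam V J" "?f x = ?f y"
    show "x = y"
    proof (rule hdual_eqI)
      fix i assume "i \<in> nodes L"
      with fun_cong[OF *(3), of i] show "x (coroot L i) = y (coroot L i)" by simp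
    qed (use * wt_J_hdual in auto)
  qed
  moreover have "?f ` wt_J L lam V J \<subseteq> (\<Pi>\<^sub>E i\<in>nodes L. of_int ` {- N i..N i})" using bound by blast
  moreover have "finite (\<Pi>\<^sub>E i\<in>nodes L. (of_int ` {- N i..N i} :: complex set))"
    by (intro finite_PiE) auto
  ultimately show ?thesis by (rule inj_on_finite)
qed

section \<open>Maximizer subsets\<close>

text \<open>In coordinates the pairing is a sum of products of nonnegative factors, so it vanishes
  only if each product does; the scale factors are positive.\<close>

lemma hform_zplus_Nonneg:
  assumes K: "K \<subseteq> nodes L" and \<nu>: "\<nu> \<in> hdual L" "\<forall>j\<in>K. \<nu> (coroot L j) \<in> \<real>\<^sub>\<ge>\<^sub>0"
    and \<gamma>: "\<gamma> \<in> zplus L K"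
  shows "hform L \<nu> \<gamma> \<in> \<real>\<^sub>\<ge>\<^sub>0"
    and "hform L \<nu> \<gamma> = 0 \<longleftrightarrow> \<gamma> \<in> zplus L {j \<in> K. \<nu> (coroot L j) = 0}"
proof -
  let ?t = "\<lambda>i. coeff \<gamma> i * of_real (coroot_scale i) * \<nu> (coroot L i)"
  have eq: "hform L \<nu> \<gamma> = (\<Sum>i\<in>nodes L. ?t i)"
    using hform_coeff[OF \<nu>(1) zplus_hdual[OF K \<gamma>]] .
  have t: "?t i \<in> \<real>\<^sub>\<ge>\<^sub>0" if i: "i \<in> nodes L" for i
  proof (cases "i \<in> K")
    case True
    then show ?thesis using \<gamma> i coroot_scale_pos[OF i] \<nu>(2) unfolding zplus_iff[OF K]
      by (intro nonneg_Reals_mult_I) (auto dest!: bspec[of _ _ i] elim!: Nats_cases)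
  next
    case False
    then have "coeff \<gamma> i = 0" using \<gamma> i unfolding zplus_iff[OF K] by blast
    then show ?thesis by simp
  qed
  then show "hform L \<nu> \<gamma> \<in> \<real>\<^sub>\<ge>\<^sub>0" unfolding eq by (intro nonneg_Reals_sum)
  have Re: "?t i = complex_of_real (Re (?t i))" "0 \<le> Re (?t i)" if "i \<in> nodes L" for i
    using t[OF that] by (rule nonneg_Reals_Re)+
  have "hform L \<nu> \<gamma> = complex_of_real (\<Sum>i\<in>nodes L. Re (?t i))"
    unfolding eq of_real_sum by (rule sum.cong) (simp_all only: Re(1)[symmetric])
  then have "hform L \<nu> \<gamma> = 0 \<longleftrightarrow> (\<Sum>i\<in>nodes L. Re (?t i)) = 0"
    by (simp only: of_real_eq_0_iff)
  also have "\<dots> \<longleftrightarrow> (\<forall>i\<in>nodes L. Re (?t i) = 0)" using Re(2) by (intro sum_nonneg_eq_0_iff) auto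
  also have "\<dots> \<longleftrightarrow> (\<forall>i\<in>nodes L. ?t i = 0)" using Re(1) by (metis of_real_0 zero_complex.sel(1))
  also have "\<dots> \<longleftrightarrow> (\<forall>i\<in>nodes L. coeff \<gamma> i = 0 \<or> \<nu> (coroot L i) = 0)"
    using coroot_scale_pos by fastforce
  also have "\<dots> \<longleftrightarrow> \<gamma> \<in> zplus L {j \<in> K. \<nu> (coroot L j) = 0}"
  proof -
    have "{j \<in> K. \<nu> (coroot L j) = 0} \<subseteq> nodes L" using K by blast
    from zplus_iff[OF this] show ?thesis using \<gamma> unfolding zplus_iff[OF K] by blast
  qed
  finally show "hform L \<nu> \<gamma> = 0 \<longleftrightarrow> \<gamma> \<in> zplus L {j \<in> K. \<nu> (coroot L j) = 0}" .
qed

text \<open>The common source of both maximizer equalities, for two choices of \<open>\<nu>\<close>.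
  As \<open>lam\<close> lies in the set, a maximizer is a weight whose difference from
  \<open>lam\<close> pairs to 0 with \<open>\<nu>\<close>.\<close>

lemma maximizer_eq:
  assumes K: "K \<subseteq> nodes L" and \<nu>: "\<nu> \<in> hdual L" "\<forall>j\<in>K. \<nu> (coroot L j) \<in> \<real>\<^sub>\<ge>\<^sub>0"
  shows "maximizer L (wt_J L lam V K) \<nu> = wt_J L lam V {j \<in> K. \<nu> (coroot L j) = 0}"
proof -
  let ?K = "{j \<in> K. \<nu> (coroot L j) = 0}"
  note pos = hform_zplus_Nonneg[OF K \<nu>]
  have lin: "hform L \<nu> lam - hform L \<nu> x = hform L \<nu> (lam - x)" if "x \<in> wt_J L lam V K" for x
    by (rule hform_diff_right[symmetric, OF \<nu>(1) lam_hdual wt_J_hdual[OF that]])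
  have sub: "wt_J L lam V ?K \<subseteq> wt_J L lam V K"
    using K by (intro wt_J_mono) auto
  show ?thesis
  proof (intro set_eqI iffI)
    fix x assume x: "x \<in> maximizer L (wt_J L lam V K) \<nu>"
    then have xK: "x \<in> wt_J L lam V K" and "hform L \<nu> x - hform L \<nu> lam \<in> \<real>\<^sub>\<ge>\<^sub>0"
      using lam_wt_J unfolding maximizer_def by blast+
    then have "- hform L \<nu> (lam - x) \<in> \<real>\<^sub>\<ge>\<^sub>0" unfolding lin[OF xK, symmetric] by simp
    moreover have \<gamma>: "lam - x \<in> zplus L K" using xK by (simp add: wt_J_iff)
    moreover note pos(1)[OF \<gamma>]
    ultimately have "hform L \<nu> (lam - x) = 0" by (auto simp: complex_nonneg_Reals_iff complex_eq_iff)
    with pos(2)[OF \<gamma>] xK show "x \<in> wt_J L lam V ?K" by (simp add: wt_J_iff)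
  next
    fix x assume x: "x \<in> wt_J L lam V ?K"
    with sub have xK: "x \<in> wt_J L lam V K" by blast
    then have \<gamma>: "lam - x \<in> zplus L K" by (simp add: wt_J_iff)
    have "hform L \<nu> (lam - x) = 0" using pos(2)[OF \<gamma>] x by (simp add: wt_J_iff)
    then have eq: "hform L \<nu> x = hform L \<nu> lam" using lin[OF xK] by simp
    have "hform L \<nu> x - hform L \<nu> y \<in> \<real>\<^sub>\<ge>\<^sub>0" if y: "y \<in> wt_J L lam V K" for y
      unfolding eq lin[OF y] using y by (intro pos(1)) (simp add: wt_J_iff)
    with xK show "x \<in> maximizer L (wt_J L lam V K) \<nu>" unfolding maximizer_def by blast
  qed
qed

lemma wt_J_nodes: "wt_J L lam V (nodes L) = wt L V"
  using wt_zplus wt_J_iff by blast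

lemma maximizer_rho_nodes:
  assumes J: "J \<subseteq> nodes L"
  shows "maximizer L (wt L V) (rho_nodes L (nodes L - J)) = wt_J L lam V J"
proof -
  have "{j \<in> nodes L. rho_nodes L (nodes L - J) (coroot L j) = 0} = J"
    using J by (auto simp: rho_nodes_coroot split: if_splits)
  then show ?thesis
    using maximizer_eq[OF order_refl rho_nodes_hdual[of "nodes L - J"]]
    by (simp add: wt_J_nodes rho_nodes_coroot)
qed

text \<open>
  For \<open>j \<in> K - J\<close> and a vector \<open>u\<close> of weight in \<open>wt\<^sub>J V\<close>, \<open>e\<^sub>j\<close> kills \<open>u\<close>, so integrability and
  \<open>h\<^sub>j u = 0\<close> force \<open>f\<^sub>j u = 0\<close>.
\<close>

lemma wt_J_collapse:
  assumes J: "J \<subseteq> K" and K: "K \<subseteq> J_mod L lam V v"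
    and 0: "\<And>j x. j \<in> K - J \<Longrightarrow> x \<in> wt_J L lam V J \<Longrightarrow> x (coroot L j) = 0"
  shows "wt_J L lam V K = wt_J L lam V J"
proof
  have Kn: "K \<subseteq> nodes L" and Jn: "J \<subseteq> nodes L" using J K J_mod_nodes by auto
  show "wt_J L lam V J \<subseteq> wt_J L lam V K"
    by (rule wt_J_mono[OF J Kn])
  \<comment> \<open>The tail of a nonzero monomial is nonzero. A first letter outside
    \<open>J\<close>, counted from the right, would thus act on a nonzero vector of weight in
    \<open>wt_J L lam V J\<close>.\<close>
  have lower: "set is \<subseteq> J" if "set is \<subseteq> K" "lower is \<noteq> 0" for "is"
    using that
  proof (induction "is")
    case (Cons j "is")
    then have "lower is \<noteq> 0" by auto
    then have isJ: "set is \<subseteq> J" using Cons by simp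
    have isn: "set is \<subseteq> nodes L" using isJ Jn by blast
    have "j \<in> J"
    proof (rule ccontr)
      assume "j \<notin> J"
      then have j: "j \<in> K - J" using Cons.prems by simp
      have jm: "j \<in> J_mod L lam V v" using j K by blast
      have w: "lower is \<in> weight_space L V (lam - depth is)" by (rule lower_weight[OF isn])
      have "lam - depth is \<in> wt L V"
        using w \<open>lower is \<noteq> 0\<close> by (rule wtI) (intro hdual_diff lam_hdual depth_hdual isn)
      then have "lam - depth is \<in> wt_J L lam V J"
        using depth_zplus[OF Jn isJ] unfolding wt_J_iff by (simp only: diff_diff_eq2 add_diff_cancel_left')
      then have "(lam - depth is) (coroot L j) = 0" by (rule 0[OF j])
      moreover have "act V (xplus L j) (lower is) = 0"
        using j Kn isJ isn by (intro xplus_lower) auto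
      ultimately have "act V (xminus L j) (lower is) = 0"
        using highest_vector_string[OF jm w \<open>lower is \<noteq> 0\<close>] by (metis funpow_0 funpow.simps(2) comp_apply of_nat_eq_0_iff)
      then show False using Cons.prems(2) by simp
    qed
    with isJ show ?case by simp
  qed simp
  show "wt_J L lam V K \<subseteq> wt_J L lam V J"
  proof
    fix x assume x: "x \<in> wt_J L lam V K"
    then obtain "is" where is': "set is \<subseteq> nodes L" "lower is \<noteq> 0" "x = lam - depth is"
      using wt_J_wt wt_lower by metis
    then have lx: "lam - x = depth is" by simp
    then have "set is \<subseteq> K" using x is'(1) depth_zplus_iff[OF Kn] by (simp add: wt_J_iff)
    then have "depth is \<in> zplus L J" using lower is'(2) depth_zplus[OF Jn] by blast
    with x lx show "x \<in> wt_J L lam V J" by (simp add: wt_J_iff)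
  qed
qed

lemma maximizer_proj_rho_set:
  assumes J: "J \<subseteq> J_mod L lam V v"
  shows "maximizer L (wt_J L lam V (J_mod L lam V v)) (proj L (J_mod L lam V v) (rho_set (wt_J L lam V J)))
    = wt_J L lam V J"
proof -
  let ?X = "wt_J L lam V J"
  let ?\<nu> = "proj L (J_mod L lam V v) (rho_set ?X)"
  let ?K = "{j \<in> J_mod L lam V v. ?\<nu> (coroot L j) = 0}"
  have \<nu>: "?\<nu> (coroot L j) = (\<Sum>x\<in>?X. x (coroot L j))" if "j \<in> J_mod L lam V v" for j
    unfolding proj_coroot[OF J_mod_nodes that] by (simp add: rho_set_def sum_fun_apply)
  have nat: "(\<Sum>x\<in>?X. x (coroot L j)) \<in> \<nat>" if "j \<in> J_mod L lam V v - J" for j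
    using wt_J_coroot_Nats[OF J that] by (intro Nats_sum)
  have "?\<nu> (coroot L j) \<in> \<real>\<^sub>\<ge>\<^sub>0" if j: "j \<in> J_mod L lam V v" for j
    unfolding \<nu>[OF j] using nat[of j] sum_wt_J_coroot[OF J, of j] j
    by (cases "j \<in> J") (auto elim: Nats_cases)
  then have "\<forall>j\<in>J_mod L lam V v. ?\<nu> (coroot L j) \<in> \<real>\<^sub>\<ge>\<^sub>0" by blast
  from maximizer_eq[OF J_mod_nodes proj_hdual[OF J_mod_nodes] this]
  have "maximizer L (wt_J L lam V (J_mod L lam V v)) ?\<nu> = wt_J L lam V ?K" .
  \<comment> \<open>\<open>?K\<close> may be strictly larger than \<open>J\<close>; for a
    one-dimensional module it is all of \<open>J_mod\<close> even when \<open>J\<close> is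
    empty.\<close>
  also have "\<dots> = ?X"
  proof (rule wt_J_collapse)
    show "J \<subseteq> ?K" using J \<nu> sum_wt_J_coroot[OF J] by auto
    fix j x assume j: "j \<in> ?K - J" and x: "x \<in> ?X"
    have jm: "j \<in> J_mod L lam V v - J" using j by blast
    have Re: "y (coroot L j) = complex_of_real (Re (y (coroot L j)))" "0 \<le> Re (y (coroot L j))"
      if "y \<in> ?X" for y
      using wt_J_coroot_Nats[OF J jm that] by (auto elim!: Nats_cases)
    have "(\<Sum>y\<in>?X. y (coroot L j)) = 0" using j \<nu> by auto
    from arg_cong[OF this, of Re] have "(\<Sum>y\<in>?X. Re (y (coroot L j))) = 0" by (simp only: Re_sum zero_complex.sel(1))
    \<comment> \<open>Finiteness is essential here: it lets a vanishing sum of nonnegative terms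
      force every term to vanish.\<close>
    then have "Re (x (coroot L j)) = 0"
      using sum_nonneg_eq_0_iff[OF finite_wt_J[OF J], of "\<lambda>y. Re (y (coroot L j))"] Re(2) x by simp
    then show "x (coroot L j) = 0" using Re(1)[OF x] by simp
  qed blast
  finally show ?thesis .
qed

section \<open>Detection by cardinality and sum\<close>

lemma wt_J_eqI:
  assumes J: "J \<subseteq> J_mod L lam V v" and S: "S \<subseteq> wt L V" "card S = card (wt_J L lam V J)"
    "finite S" "(\<Sum>\<mu>\<in>S. \<mu>) = (\<Sum>\<mu>\<in>wt_J L lam V J. \<mu>)"
  shows "S = wt_J L lam V J"
proof -
  let ?X = "wt_J L lam V J" and ?\<rho> = "rho_nodes L (nodes L - J)"
  have Jn: "J \<subseteq> nodes L" using J J_mod_nodes by blast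
  have \<rho>: "?\<rho> \<in> hdual L" by (rule rho_nodes_hdual) blast
  have K: "{j \<in> nodes L. ?\<rho> (coroot L j) = 0} = J"
    using Jn by (auto simp: rho_nodes_coroot split: if_splits)
  have pos: "hform L ?\<rho> (lam - x) \<in> \<real>\<^sub>\<ge>\<^sub>0" "hform L ?\<rho> (lam - x) = 0 \<longleftrightarrow> x \<in> ?X" if "x \<in> wt L V" for x
    using hform_zplus_Nonneg[OF order_refl \<rho> _ wt_zplus[OF that]] that
    unfolding K wt_J_iff by (auto simp: rho_nodes_coroot)
  \<comment> \<open>The right-hand side depends on \<open>T\<close> only through its cardinality and
    its sum, so \<open>S\<close> and \<open>?X\<close> have the same total, which is 0 for
    \<open>?X\<close>.\<close>
  have sum: "(\<Sum>x\<in>T. hform L ?\<rho> (lam - x)) = of_nat (card T) * hform L ?\<rho> lam - hform L ?\<rho> (\<Sum>x\<in>T. x)"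
    if T: "T \<subseteq> wt L V" "finite T" for T
  proof -
    have "hform L ?\<rho> (\<Sum>x\<in>T. x) = (\<Sum>x\<in>T. hform L ?\<rho> x)"
    proof -
      have Th: "x \<in> hdual L" if "x \<in> T" for x using T that wt_hdual by blast
      then have s: "(\<Sum>x\<in>T. x) \<in> hdual L" by (intro hdual_sum)
      have "hform L ?\<rho> (\<Sum>x\<in>T. x) = (\<Sum>x\<in>T. x (dual_elem L ?\<rho>))"
        unfolding hform_sym[OF \<rho> s] hform_eq[OF s \<rho>] sum_fun_apply ..
      also have "\<dots> = (\<Sum>x\<in>T. hform L ?\<rho> x)"
        by (rule sum.cong) (simp_all only: hform_sym[OF \<rho> Th] hform_eq[OF Th \<rho>])
      finally show ?thesis .
    qed
    moreover have "(\<Sum>x\<in>T. hform L ?\<rho> (lam - x)) = (\<Sum>x\<in>T. hform L ?\<rho> lam - hform L ?\<rho> x)"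
      using T wt_hdual by (intro sum.cong hform_diff_right \<rho> lam_hdual) auto
    ultimately show ?thesis by (simp add: sum_subtractf)
  qed
  have "(\<Sum>x\<in>S. hform L ?\<rho> (lam - x)) = (\<Sum>x\<in>?X. hform L ?\<rho> (lam - x))"
  proof -
    have "?X \<subseteq> wt L V" using wt_J_wt by blast
    from sum[OF this finite_wt_J[OF J]] sum[OF S(1,3)] show ?thesis by (simp only: S(2,4))
  qed
  also have "\<dots> = 0" using pos(2) wt_J_wt by (intro sum.neutral) blast
  finally have "(\<Sum>x\<in>S. Re (hform L ?\<rho> (lam - x))) = 0" by (metis Re_sum zero_complex.sel(1))
  moreover have Re: "0 \<le> Re (hform L ?\<rho> (lam - x))"
    "hform L ?\<rho> (lam - x) = complex_of_real (Re (hform L ?\<rho> (lam - x)))" if "x \<in> S" for x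
    using nonneg_Reals_Re[OF pos(1)[of x]] S(1) that by auto
  ultimately have "Re (hform L ?\<rho> (lam - x)) = 0" if "x \<in> S" for x
    using sum_nonneg_eq_0_iff[OF S(3), of "\<lambda>x. Re (hform L ?\<rho> (lam - x))"] that by simp
  then have "x \<in> ?X" if "x \<in> S" for x
    using pos(2)[of x] S(1) Re(2)[OF that] that by (metis of_real_0 subsetD)
  then show ?thesis using S(2) finite_wt_J[OF J] by (intro card_subset_eq) auto
qed

end

theorem theorem4p6:
  fixes L :: "('g::ab_group_add, 'i) chev_lie_alg"
    and V :: "('g, 'v::ab_group_add) lie_rep"
    and lam :: "'g \<Rightarrow> complex"
    and v :: 'v
    and w :: "('g \<Rightarrow> complex) \<Rightarrow> 'g \<Rightarrow> complex"
    and J :: "'i set"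
    and S :: "('g \<Rightarrow> complex) set"
  assumes "semisimple_chevalley L"
    and "lam \<in> hdual L"
    and "highest_weight_module L lam V v"
    and "w \<in> weyl_group L"
    and "w ` wt L V = wt L V"
    and "J \<subseteq> J_mod L lam V v"
    and "finite S"
    and "S \<subseteq> wt L V"
  shows "(S = w ` wt_J L lam V J \<longleftrightarrow>
            card S = card (w ` wt_J L lam V J) \<and>
            (\<Sum>\<mu>\<in>S. \<mu>) = (\<Sum>\<mu>\<in>w ` wt_J L lam V J. \<mu>)) \<and>
         wt_J L lam V J = maximizer L (wt L V) (rho_nodes L (nodes L - J)) \<and>
         maximizer L (wt L V) (rho_nodes L (nodes L - J)) =
           maximizer L (wt_J L lam V (J_mod L lam V v))
             (proj L (J_mod L lam V v) (rho_set (wt_J L lam V J)))"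
proof -
  interpret semisimple_chevalley L by (fact assms(1))
  interpret highest_weight L lam V v using assms(2,3) by unfold_locales
  note J = assms(6)
  let ?X = "wt_J L lam V J"
  have Jn: "J \<subseteq> nodes L" using J J_mod_nodes by blast
  have inj: "inj_on w (hdual L)" and maps: "w ` hdual L \<subseteq> hdual L"
    using weyl_group_additive[OF assms(4)] by auto
  have X: "?X \<subseteq> hdual L" using wt_J_hdual by blast
  have "S = w ` ?X" if card: "card S = card (w ` ?X)" and sum: "(\<Sum>\<mu>\<in>S. \<mu>) = (\<Sum>\<mu>\<in>w ` ?X. \<mu>)"
  proof -
    \<comment> \<open>Since \<open>w\<close> permutes the weights, \<open>S\<close> is the image of
      a set of weights; injectivity and additivity of \<open>w\<close> carry both numerical
      conditions over to that set.\<close>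
    obtain T where T: "T \<subseteq> wt L V" "S = w ` T" using assms(5,8) by (metis subset_imageE)
    have Th: "T \<subseteq> hdual L" using T(1) wt_hdual by blast
    have injT: "inj_on w T" and injX: "inj_on w ?X" using inj_on_subset[OF inj] Th X by auto
    have finT: "finite T" using assms(7) T(2) injT by (simp add: finite_image_iff)
    have "w (\<Sum>\<mu>\<in>T. \<mu>) = (\<Sum>\<mu>\<in>S. \<mu>)"
      unfolding T(2) sum.reindex[OF injT] using weyl_group_sum[OF assms(4) Th] by simp
    also have "\<dots> = w (\<Sum>\<mu>\<in>?X. \<mu>)"
      unfolding sum sum.reindex[OF injX] using weyl_group_sum[OF assms(4) X] by simp
    finally have "(\<Sum>\<mu>\<in>T. \<mu>) = (\<Sum>\<mu>\<in>?X. \<mu>)"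
      using inj Th X by (auto dest!: inj_onD intro!: hdual_sum)
    then have "T = ?X"
      using T card finT injT injX by (intro wt_J_eqI[OF J]) (simp_all add: card_image)
    then show ?thesis using T(2) by simp
  qed
  then show ?thesis
    using maximizer_rho_nodes[OF Jn] maximizer_proj_rho_set[OF J] by metis
qed

end
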